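(* If $X$ and $Y$ are infinite, compact, $0$-dimensional Hausdorff spaces, either both with the same finite number of isolated points or both having a dense set of isolated points, then $C(X)\equiv C(Y)$. In particular, for any infinite ordinal $\alpha$, $C(\alpha+1)\equiv C(\beta\omega)$. Moreover, if $\alpha$ is a countable limit ordinal, then $C(2^\omega)\equiv C(\beta\omega\setminus\omega)\equiv C(\beta\alpha\setminus\alpha)$.
   Context: $C(X)$ is the C*-algebra of continuous complex-valued functions on the compact Hausdorff space $X$; a space is $0$-dimensional if it has a basis of clopen sets. Ordinals carry the order topology, $\beta Z$ is the Stone–Čech compactification of $Z$, and $2^\omega$ is the Cantor space. $\equiv$ denotes elementary equivalence of C*-algebras in continuous logic: formulas are built from norms $\|P(\bar x)\|$ of $*$-polynomials with complex coefficients (constant terms being allowed for unital algebras) by applying continuous real functions and taking $\sup$ and $\inf$ over variables ranging over the closed unit ball; a sentence is a formula without free variables; $A\equiv B$ if the same sentences have value $0$ in $A$ and in $B$. *)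

theory Defs
  imports "HOL-Analysis.Analysis" "HOL-Algebra.Module"
begin

section \<open>Unital C*-algebras as structures, and \<open>C(X)\<close>\<close>

record 'a star_algebra = "(complex, 'a) module" +
  star :: "'a \<Rightarrow> 'a"
  nrm :: "'a \<Rightarrow> real"

text \<open>
  Elements of \<open>C(X)\<close> are represented extensionally (\<^const>\<open>undefined\<close> off the space).
  The \<open>0\<close> inserted into the supremum norm only matters for the empty space.
\<close>

definition C_alg :: "'a topology \<Rightarrow> ('a \<Rightarrow> complex) star_algebra" where
  "C_alg X =
    \<lparr> carrier = {f \<in> extensional (topspace X). continuous_map X euclidean f},
      monoid.mult = (\<lambda>f g. \<lambda>x\<in>topspace X. f x * g x),
      one = (\<lambda>x\<in>topspace X. 1),
      zero = (\<lambda>x\<in>topspace X. 0),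
      add = (\<lambda>f g. \<lambda>x\<in>topspace X. f x + g x),
      smult = (\<lambda>c f. \<lambda>x\<in>topspace X. c * f x),
      star = (\<lambda>f. \<lambda>x\<in>topspace X. cnj (f x)),
      nrm = (\<lambda>f. Sup (insert 0 ((\<lambda>x. cmod (f x)) ` topspace X))) \<rparr>"

definition unit_ball :: "('a, 'm) star_algebra_scheme \<Rightarrow> 'a set" where
  "unit_ball A = {a \<in> carrier A. nrm A a \<le> 1}"


section \<open>Continuous logic for unital C*-algebras\<close>

text \<open>
  *-polynomials in noncommuting variables; a constant term \<open>c\<close> is \<open>P_Scale c P_One\<close>.
\<close>

datatype star_poly =
    P_Var nat
  | P_One
  | P_Add star_poly star_poly
  | P_Mult star_poly star_poly
  | P_Scale complex star_poly
  | P_Star star_poly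

text \<open>
  In \<open>Conn u \<phi>s\<close> the connective \<open>u\<close> has arity \<open>length \<phi>s\<close>. It is given on sequences of reals, of
  which only those vanishing from index \<open>length \<phi>s\<close> on (that is, the points of
  \<open>Euclidean_space (length \<phi>s)\<close>) are relevant.
\<close>

datatype cl_formula =
    Norm star_poly
  | Conn "(nat \<Rightarrow> real) \<Rightarrow> real" "cl_formula list"
  | SupBall nat cl_formula
  | InfBall nat cl_formula

primrec poly_vars :: "star_poly \<Rightarrow> nat set" where
  "poly_vars (P_Var i) = {i}"
| "poly_vars P_One = {}"
| "poly_vars (P_Add p q) = poly_vars p \<union> poly_vars q"
| "poly_vars (P_Mult p q) = poly_vars p \<union> poly_vars q"
| "poly_vars (P_Scale c p) = poly_vars p"
| "poly_vars (P_Star p) = poly_vars p"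

fun free_vars :: "cl_formula \<Rightarrow> nat set" where
  "free_vars (Norm p) = poly_vars p"
| "free_vars (Conn u \<phi>s) = (\<Union>\<phi>\<in>set \<phi>s. free_vars \<phi>)"
| "free_vars (SupBall i \<phi>) = free_vars \<phi> - {i}"
| "free_vars (InfBall i \<phi>) = free_vars \<phi> - {i}"

fun wf_formula :: "cl_formula \<Rightarrow> bool" where
  "wf_formula (Norm p) \<longleftrightarrow> True"
| "wf_formula (Conn u \<phi>s) \<longleftrightarrow>
    continuous_map (Euclidean_space (length \<phi>s)) euclideanreal u \<and> (\<forall>\<phi>\<in>set \<phi>s. wf_formula \<phi>)"
| "wf_formula (SupBall i \<phi>) \<longleftrightarrow> wf_formula \<phi>"
| "wf_formula (InfBall i \<phi>) \<longleftrightarrow> wf_formula \<phi>"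

definition cl_sentence :: "cl_formula \<Rightarrow> bool" where
  "cl_sentence \<phi> \<longleftrightarrow> wf_formula \<phi> \<and> free_vars \<phi> = {}"

primrec poly_val :: "('a, 'm) star_algebra_scheme \<Rightarrow> (nat \<Rightarrow> 'a) \<Rightarrow> star_poly \<Rightarrow> 'a" where
  "poly_val A s (P_Var i) = s i"
| "poly_val A s P_One = \<one>\<^bsub>A\<^esub>"
| "poly_val A s (P_Add p q) = poly_val A s p \<oplus>\<^bsub>A\<^esub> poly_val A s q"
| "poly_val A s (P_Mult p q) = poly_val A s p \<otimes>\<^bsub>A\<^esub> poly_val A s q"
| "poly_val A s (P_Scale c p) = c \<odot>\<^bsub>A\<^esub> poly_val A s p"
| "poly_val A s (P_Star p) = star A (poly_val A s p)"

fun cl_val :: "('a, 'm) star_algebra_scheme \<Rightarrow> (nat \<Rightarrow> 'a) \<Rightarrow> cl_formula \<Rightarrow> real" where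
  "cl_val A s (Norm p) = nrm A (poly_val A s p)"
| "cl_val A s (Conn u \<phi>s) =
    u (\<lambda>i. if i < length \<phi>s then map (cl_val A s) \<phi>s ! i else 0)"
| "cl_val A s (SupBall i \<phi>) = (SUP a\<in>unit_ball A. cl_val A (s(i := a)) \<phi>)"
| "cl_val A s (InfBall i \<phi>) = (INF a\<in>unit_ball A. cl_val A (s(i := a)) \<phi>)"

lemma poly_val_cong:
  "(\<And>i. i \<in> poly_vars p \<Longrightarrow> s i = t i) \<Longrightarrow> poly_val A s p = poly_val A t p"
  by (induction p) simp_all

lemma cl_val_cong:
  "(\<forall>i\<in>free_vars \<phi>. s i = t i) \<Longrightarrow> cl_val A s \<phi> = cl_val A t \<phi>"
proof (induction \<phi> arbitrary: s t)
  case (Norm p)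
  have "poly_val A s p = poly_val A t p"
    by (rule poly_val_cong) (use Norm in simp)
  then show ?case by simp
next
  case (Conn u \<phi>s)
  have "cl_val A s \<phi> = cl_val A t \<phi>" if "\<phi> \<in> set \<phi>s" for \<phi>
    by (rule Conn.IH[OF that]) (use that Conn.prems in \<open>simp only: free_vars.simps, blast\<close>)
  then have "map (cl_val A s) \<phi>s = map (cl_val A t) \<phi>s" by simp
  then show ?case by (simp only: cl_val.simps)
next
  case (SupBall i \<phi>)
  have "cl_val A (s(i := a)) \<phi> = cl_val A (t(i := a)) \<phi>" for a
    by (rule SupBall.IH) (use SupBall.prems in simp)
  then show ?case by (simp only: cl_val.simps)
next
  case (InfBall i \<phi>)
  have "cl_val A (s(i := a)) \<phi> = cl_val A (t(i := a)) \<phi>" for a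
    by (rule InfBall.IH) (use InfBall.prems in simp)
  then show ?case by (simp only: cl_val.simps)
qed

text \<open>
  By \<open>cl_val_cong\<close>, the assignment used to evaluate a sentence is irrelevant.
\<close>

definition elem_equiv ::
    "('a, 'm) star_algebra_scheme \<Rightarrow> ('b, 'n) star_algebra_scheme \<Rightarrow> bool"  (infix \<open>\<equiv>\<^sub>e\<close> 50) where
  "A \<equiv>\<^sub>e B \<longleftrightarrow>
    (\<forall>\<phi>. cl_sentence \<phi> \<longrightarrow> (cl_val A (\<lambda>_. \<zero>\<^bsub>A\<^esub>) \<phi> = 0 \<longleftrightarrow> cl_val B (\<lambda>_. \<zero>\<^bsub>B\<^esub>) \<phi> = 0))"


section \<open>Topological notions\<close>

definition zero_dimensional_space :: "'a topology \<Rightarrow> bool" where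
  "zero_dimensional_space X \<longleftrightarrow>
    (\<exists>\<B>. (\<forall>B\<in>\<B>. openin X B \<and> closedin X B) \<and> openin X = arbitrary union_of (\<lambda>B. B \<in> \<B>))"

definition isolated_points :: "'a topology \<Rightarrow> 'a set" where
  "isolated_points X = {x \<in> topspace X. openin X {x}}"

definition cantor_space :: "(nat \<Rightarrow> bool) topology" where
  "cantor_space = product_topology (\<lambda>_. discrete_topology UNIV) UNIV"

text \<open>
  The Stone--Cech compactification, as the closure of the image of \<open>Z\<close> under the evaluation map
  into the cube \<open>[0,1]\<^bsup>C(Z,[0,1])\<^esup>\<close>.
\<close>

definition unit_functions :: "'a topology \<Rightarrow> ('a \<Rightarrow> real) set" where
  "unit_functions Z =
    {f \<in> extensional (topspace Z). continuous_map Z (top_of_set {0..1}) f}"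

definition sc_cube :: "'a topology \<Rightarrow> (('a \<Rightarrow> real) \<Rightarrow> real) topology" where
  "sc_cube Z = product_topology (\<lambda>_. top_of_set {0..1}) (unit_functions Z)"

definition sc_embed :: "'a topology \<Rightarrow> 'a \<Rightarrow> ('a \<Rightarrow> real) \<Rightarrow> real" where
  "sc_embed Z z = (\<lambda>f\<in>unit_functions Z. f z)"

definition stone_cech :: "'a topology \<Rightarrow> (('a \<Rightarrow> real) \<Rightarrow> real) topology" where
  "stone_cech Z =
    subtopology (sc_cube Z) (sc_cube Z closure_of (sc_embed Z ` topspace Z))"

definition sc_remainder :: "'a topology \<Rightarrow> (('a \<Rightarrow> real) \<Rightarrow> real) topology" where
  "sc_remainder Z =
    subtopology (stone_cech Z) (topspace (stone_cech Z) - sc_embed Z ` topspace Z)"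


section \<open>Ordinals\<close>

text \<open>
  An ordinal is represented by a well-order \<open>r\<close> (in the sense of \<^term>\<open>Well_order r\<close>) on the set
  \<^term>\<open>Field r\<close>. The whole space is among the generators of the order topology because the open
  rays do not cover a one-point order.
\<close>

definition ord_topology :: "'a rel \<Rightarrow> 'a topology" where
  "ord_topology r =
    topology_generated_by (insert (Field r) (underS r ` Field r \<union> aboveS r ` Field r))"

text \<open>The ordinal \<open>\<alpha> + 1\<close>: a new element \<^const>\<open>None\<close> is put on top of \<open>\<alpha>\<close>.\<close>

definition ord_Suc :: "'a rel \<Rightarrow> 'a option rel" where
  "ord_Suc r =
    {(Some x, Some y) | x y. (x, y) \<in> r} \<union> {(Some x, None) | x. x \<in> Field r} \<union> {(None, None)}"

definition limit_ordinal :: "'a rel \<Rightarrow> bool" where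
  "limit_ordinal r \<longleftrightarrow>
    Well_order r \<and> Field r \<noteq> {} \<and> (\<forall>x\<in>Field r. \<exists>y\<in>Field r. (x, y) \<in> r \<and> x \<noteq> y)"

abbreviation omega_space :: "nat topology" where
  "omega_space \<equiv> ord_topology natLeq"

end

theory Submission
  imports Defs
begin

text \<open>
  The three parts are instances of one criterion, \<open>tame_spaces_elem_equiv\<close>. For a compact Hausdorff
  space \<open>X\<close> with a basis of clopen sets, suppose that the closure of the set of isolated points is
  clopen. Then \<open>X\<close> is the disjoint union of a clopen part in which isolated points are dense and a
  clopen part without isolated points, and the theory of \<open>C(X)\<close> depends only on the number of isolated
  points (all infinite cardinalities count as one) and on whether the second part is empty.

  The proof of the criterion is an Ehrenfeucht--Fraisse game. Functions in the unit ball can be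
  approximated by locally constant functions with values in a fixed finite net \<open>D\<close> of the unit disc, so
  up to an error a move in the game cuts every piece of a clopen partition into at most \<open>card D\<close>
  clopen pieces. With \<open>k\<close> moves to go, two pieces need to agree only in the number of isolated points,
  counted up to the threshold \<open>card D ^ k\<close>, and in whether they reach into the perfect part
  (\<open>similar\<close>): \<open>similar_split\<close> shows that the opponent can always answer. Fixing the net before the
  game starts is essential. Without a bound on the number of pieces, \<open>\<omega> + 1\<close> and \<open>\<beta>\<omega>\<close> could be told
  apart in two moves, as only the second one splits into two infinite clopen sets. The value of a
  formula is then controlled by induction (\<open>matched_imp_close\<close>): norms of polynomials because
  corresponding pieces are empty at the same time and carry nearly equal values, connectives by uniform
  continuity on compact boxes, and quantifiers by the game.

  It remains to analyse the spaces. In a successor ordinal the least element of an open set is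
  isolated, and in \<open>\<beta>\<omega>\<close> the points of \<open>\<omega>\<close> are isolated and dense, so both have infinitely many
  isolated points and these are dense. The Cantor space, \<open>\<beta>\<omega> - \<omega>\<close> and \<open>\<beta>\<alpha> - \<alpha>\<close> have no isolated points at
  all. For the remainders this comes from a locally constant map \<open>\<rho>\<close> from \<open>\<alpha>\<close> to \<open>\<omega>\<close>
  with compact sublevel sets: a clopen set meets the remainder iff \<open>\<rho>\<close> is unbounded on its trace
  (\<open>clopen_meets_remainder_iff\<close>), and an unbounded trace can be cut into two unbounded ones.
\<close>

section \<open>Clopen sets and locally constant functions\<close>

definition clopenin :: "'a topology \<Rightarrow> 'a set \<Rightarrow> bool" where
  "clopenin X K \<longleftrightarrow> openin X K \<and> closedin X K"

definition totally_separated_space :: "'a topology \<Rightarrow> bool" where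
  "totally_separated_space X \<longleftrightarrow>
    (\<forall>x\<in>topspace X. \<forall>y\<in>topspace X. x \<noteq> y \<longrightarrow> (\<exists>K. clopenin X K \<and> x \<in> K \<and> y \<notin> K))"

definition locally_constant :: "'a topology \<Rightarrow> ('a \<Rightarrow> 'c) \<Rightarrow> bool" where
  "locally_constant X f \<longleftrightarrow> (\<forall>c. openin X {x \<in> topspace X. f x = c})"

lemma totally_separatedD:
  "totally_separated_space X \<Longrightarrow> x \<in> topspace X \<Longrightarrow> y \<in> topspace X \<Longrightarrow> x \<noteq> y \<Longrightarrow>
    \<exists>K. clopenin X K \<and> x \<in> K \<and> y \<notin> K"
  by (simp add: totally_separated_space_def)

lemma clopenin_subset: "clopenin X K \<Longrightarrow> K \<subseteq> topspace X"
  by (simp add: clopenin_def openin_subset)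

lemma clopenin_simps [simp]: "clopenin X {}" "clopenin X (topspace X)"
  by (auto simp: clopenin_def)

lemma clopenin_Int: "clopenin X K \<Longrightarrow> clopenin X L \<Longrightarrow> clopenin X (K \<inter> L)"
  by (auto simp: clopenin_def)

lemma clopenin_Diff: "clopenin X K \<Longrightarrow> clopenin X L \<Longrightarrow> clopenin X (K - L)"
  by (auto simp: clopenin_def openin_diff closedin_diff)

lemma clopenin_compl: "clopenin X K \<Longrightarrow> clopenin X (topspace X - K)"
  by (simp add: clopenin_Diff)

lemma clopenin_finite_Inter:
  "finite \<K> \<Longrightarrow> \<K> \<noteq> {} \<Longrightarrow> (\<And>K. K \<in> \<K> \<Longrightarrow> clopenin X K) \<Longrightarrow> clopenin X (\<Inter>\<K>)"
  unfolding clopenin_def by (metis openin_Inter closedin_Inter)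

lemma clopenin_preimage:
  "continuous_map X Y f \<Longrightarrow> clopenin Y K \<Longrightarrow> clopenin X {x \<in> topspace X. f x \<in> K}"
  by (auto simp: clopenin_def openin_continuous_map_preimage closedin_continuous_map_preimage)

lemma clopenin_locally_constant_preimage:
  assumes "locally_constant X f"
  shows "clopenin X {x \<in> topspace X. f x \<in> S}"
proof -
  have op: "openin X {x \<in> topspace X. f x \<in> T}" for T
  proof -
    have "{x \<in> topspace X. f x \<in> T} = (\<Union>c\<in>T. {x \<in> topspace X. f x = c})" by auto
    then show ?thesis using assms by (auto simp: locally_constant_def)
  qed
  have "topspace X - {x \<in> topspace X. f x \<in> S} = {x \<in> topspace X. f x \<in> - S}" by auto
  then show ?thesis using op[of S] op[of "- S"] by (auto simp: clopenin_def closedin_def)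
qed

lemma locally_constant_const: "locally_constant X (\<lambda>_. c)"
  unfolding locally_constant_def
proof
  fix c'
  show "openin X {x \<in> topspace X. c = c'}" by (cases "c = c'") auto
qed

lemma locally_constant_comp:
  assumes "locally_constant X f"
  shows "locally_constant X (\<lambda>x. h (f x))"
  unfolding locally_constant_def
proof
  fix c
  show "openin X {x \<in> topspace X. h (f x) = c}"
    using clopenin_locally_constant_preimage[OF assms, of "h -` {c}"] by (simp add: clopenin_def)
qed

lemma locally_constant_glue:
  assumes f: "locally_constant X f" and g: "\<And>l. locally_constant X (g l)"
  shows "locally_constant X (\<lambda>x. g (f x) x)"
  unfolding locally_constant_def
proof
  fix c
  have "{x \<in> topspace X. g (f x) x = c} =
      (\<Union>l. {x \<in> topspace X. f x = l} \<inter> {x \<in> topspace X. g l x = c})" by auto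
  also have "openin X \<dots>"
    by (intro openin_Union) (use f g in \<open>auto simp: locally_constant_def\<close>)
  finally show "openin X {x \<in> topspace X. g (f x) x = c}" .
qed

lemma locally_constant_mem:
  assumes "clopenin X K"
  shows "locally_constant X (\<lambda>x. x \<in> K)"
  unfolding locally_constant_def
proof
  fix c
  have "{x \<in> topspace X. (x \<in> K) = c} = (if c then K else topspace X - K)"
    using clopenin_subset[OF assms] by auto
  then show "openin X {x \<in> topspace X. (x \<in> K) = c}"
    using assms clopenin_compl[OF assms] by (auto simp: clopenin_def)
qed

lemma locally_constant_if:
  assumes "clopenin X K" "locally_constant X f" "locally_constant X g"
  shows "locally_constant X (\<lambda>x. if x \<in> K then f x else g x)"
  using locally_constant_glue[OF locally_constant_mem[OF assms(1)], of "\<lambda>b. if b then f else g"] assms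
  by (simp add: if_distrib[of "\<lambda>h. h _"] cong: if_cong)

lemma locally_constant_imp_continuous_map:
  assumes "locally_constant X f" "range f \<subseteq> topspace Y"
  shows "continuous_map X Y f"
  using assms clopenin_locally_constant_preimage[OF assms(1)] by (auto simp: continuous_map_def clopenin_def)

lemma compact_totally_separated_imp_clopen_neighbourhood:
  assumes X: "compact_space X" "totally_separated_space X" and U: "openin X U" "x \<in> U"
  shows "\<exists>K. clopenin X K \<and> x \<in> K \<and> K \<subseteq> U"
proof -
  have x: "x \<in> topspace X" using U openin_subset by blast
  have "compactin X (topspace X - U)"
    using X(1) U(1) by (intro closedin_compact_space) auto
  let ?\<U> = "{topspace X - K | K. clopenin X K \<and> x \<in> K}"
  have 1: "\<forall>V\<in>?\<U>. openin X V" by (auto simp: clopenin_def)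
  have 2: "topspace X - U \<subseteq> \<Union>?\<U>"
  proof
    fix y assume y: "y \<in> topspace X - U"
    then have "x \<noteq> y" using U by auto
    then obtain K where "clopenin X K" "x \<in> K" "y \<notin> K"
      using X(2) x y by (auto simp: totally_separated_space_def)
    then show "y \<in> \<Union>?\<U>" using y by blast
  qed
  obtain \<F> where \<F>: "finite \<F>" "\<F> \<subseteq> ?\<U>" "topspace X - U \<subseteq> \<Union>\<F>"
    using \<open>compactin X (topspace X - U)\<close> 1 2 unfolding compactin_def by meson
  let ?\<K> = "insert (topspace X) ((\<lambda>V. topspace X - V) ` \<F>)"
  have K: "clopenin X K \<and> x \<in> K" if "K \<in> ?\<K>" for K
  proof (cases "K = topspace X")
    case False
    then obtain V where "V \<in> \<F>" "K = topspace X - V" using \<open>K \<in> ?\<K>\<close> by blast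
    then obtain L where "clopenin X L" "x \<in> L" "K = topspace X - (topspace X - L)"
      using \<F>(2) by blast
    then show ?thesis
      using clopenin_subset[of X L] by (simp add: double_diff)
  qed (use x in auto)
  have "clopenin X (\<Inter>?\<K>)" using \<F>(1) K by (intro clopenin_finite_Inter) auto
  moreover have "x \<in> \<Inter>?\<K>" using K by blast
  moreover have "\<Inter>?\<K> \<subseteq> U" using \<F>(3) by blast
  ultimately show ?thesis by blast
qed

text \<open>
  By compactness finitely many clopen sets, on each of which \<open>a\<close> stays close to a single element of
  \<open>D\<close>, cover the space. Taking the values in a prescribed set \<open>D\<close> is what later bounds the number of
  pieces of a partition.
\<close>

lemma locally_constant_approximation:
  fixes a :: "'a \<Rightarrow> 'c :: metric_space"
  assumes X: "compact_space X" "totally_separated_space X" and a: "continuous_map X euclidean a"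
    and D: "\<And>x. x \<in> topspace X \<Longrightarrow> \<exists>c\<in>D. dist (a x) c < \<delta>"
  shows "\<exists>d. locally_constant X d \<and> (\<forall>x\<in>topspace X. d x \<in> D \<and> dist (a x) (d x) < \<delta>)"
proof -
  let ?\<U> = "{K. clopenin X K \<and> (\<exists>c\<in>D. \<forall>x\<in>K. dist (a x) c < \<delta>)}"
  have 2: "topspace X \<subseteq> \<Union>?\<U>"
  proof
    fix x assume x: "x \<in> topspace X"
    then obtain c where c: "c \<in> D" "dist (a x) c < \<delta>" using D by blast
    have "openin X {y \<in> topspace X. a y \<in> ball c \<delta>}"
      using openin_continuous_map_preimage[OF a, of "ball c \<delta>"] by simp
    moreover have "x \<in> {y \<in> topspace X. a y \<in> ball c \<delta>}" using x c by (simp add: dist_commute)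
    ultimately obtain K where K: "clopenin X K" "x \<in> K" "K \<subseteq> {y \<in> topspace X. a y \<in> ball c \<delta>}"
      using compact_totally_separated_imp_clopen_neighbourhood[OF X] by blast
    then have "\<forall>x\<in>K. dist (a x) c < \<delta>" by (auto simp: dist_commute)
    then show "x \<in> \<Union>?\<U>" using c K by blast
  qed
  have "\<forall>V\<in>?\<U>. openin X V" by (auto simp: clopenin_def)
  then obtain \<F> where \<F>: "finite \<F>" "\<F> \<subseteq> ?\<U>" "topspace X \<subseteq> \<Union>\<F>"
    using X(1) 2 unfolding compact_space_def compactin_def by meson
  have "\<exists>d. locally_constant X d \<and> (\<forall>x\<in>\<Union>\<F>. d x \<in> D \<and> dist (a x) (d x) < \<delta>)"
    using \<F>(1,2)
  proof (induction \<F>)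
    case empty
    then show ?case using locally_constant_const[of X undefined] by auto
  next
    case (insert K \<F>)
    then obtain d c where d: "locally_constant X d" "\<forall>x\<in>\<Union>\<F>. d x \<in> D \<and> dist (a x) (d x) < \<delta>"
      and c: "clopenin X K" "c \<in> D" "\<forall>x\<in>K. dist (a x) c < \<delta>" by auto
    have "locally_constant X (\<lambda>x. if x \<in> K then c else d x)"
      by (intro locally_constant_if c d locally_constant_const)
    then show ?case using c d by (intro exI[of _ "\<lambda>x. if x \<in> K then c else d x"]) auto
  qed
  then show ?thesis using \<F>(3) by blast
qed


section \<open>Splitting clopen sets\<close>

definition trunc_card :: "nat \<Rightarrow> 'a set \<Rightarrow> nat" where
  "trunc_card T S = (if finite S then min (card S) T else T)"

lemma trunc_card_bij_betw: "bij_betw h S S' \<Longrightarrow> trunc_card T S = trunc_card T S'"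
  by (auto simp: trunc_card_def bij_betw_finite bij_betw_same_card)

lemma trunc_card_eq_0_iff: "T > 0 \<Longrightarrow> trunc_card T S = 0 \<longleftrightarrow> S = {}"
  by (auto simp: trunc_card_def min_def)

lemma trunc_card_le: "trunc_card T S \<le> T"
  by (auto simp: trunc_card_def)

lemma trunc_card_eq_boundD: "trunc_card T S = T \<Longrightarrow> infinite S \<or> T \<le> card S"
  by (cases "T \<le> card S") (auto simp: trunc_card_def)

lemma trunc_card_eq_bound: "finite W \<Longrightarrow> W \<subseteq> S \<Longrightarrow> T \<le> card W \<Longrightarrow> trunc_card T S = T"
  using card_mono[of S W] by (auto simp: trunc_card_def)

text \<open>
  A colouring of \<open>S\<close> can be imitated on \<open>S'\<close>, with counts up to \<open>T\<close>, if the sizes agree up to the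
  larger threshold \<open>card D * T\<close>. Below the threshold a bijection transports the colouring. Otherwise some
  fibre of \<open>f\<close>, of colour \<open>c0\<close> say, has at least \<open>T\<close> points, and in \<open>S'\<close> the colour \<open>c0\<close> can absorb
  everything but at most \<open>T\<close> points for each other colour. All other fibres are
  finite, and finite sets of isolated points are clopen; so a colouring of isolated points extends to a
  locally constant function with default value \<open>c0\<close>.
\<close>

lemma match_colouring:
  assumes D: "finite D" "D \<noteq> {}" and f: "\<And>x. x \<in> S \<Longrightarrow> f x \<in> D"
    and tr: "trunc_card (card D * T) S = trunc_card (card D * T) S'"
  shows "\<exists>g. \<exists>c0\<in>D. (\<forall>y\<in>S'. g y \<in> D) \<and>
    (\<forall>c\<in>D. trunc_card T {x\<in>S. f x = c} = trunc_card T {y\<in>S'. g y = c}) \<and>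
    (\<forall>c\<in>D. c \<noteq> c0 \<longrightarrow> finite {y\<in>S'. g y = c})"
proof (cases "finite S \<and> card S < card D * T")
  case True
  then have "finite S'" "card S = card S'"
    using tr by (auto simp: trunc_card_def min_def split: if_splits)
  then obtain h where h: "bij_betw h S' S"
    using True finite_same_card_bij by metis
  have "trunc_card T {x\<in>S. f x = c} = trunc_card T {y\<in>S'. (f \<circ> h) y = c}" for c
  proof -
    have "bij_betw h {y\<in>S'. (f \<circ> h) y = c} {x\<in>S. f x = c}"
      using h by (auto simp: bij_betw_def inj_on_def)
    then show ?thesis by (rule trunc_card_bij_betw[symmetric])
  qed
  moreover have "\<forall>y\<in>S'. (f \<circ> h) y \<in> D" using f h by (auto simp: bij_betw_def)
  ultimately show ?thesis
    using \<open>finite S'\<close> D(2) by (intro exI[of _ "f \<circ> h"]) auto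
next
  case False
  then have "trunc_card (card D * T) S' = card D * T"
    using tr by (simp add: trunc_card_def min_def split: if_splits)
  then have "infinite S' \<or> card D * T \<le> card S'"
    by (rule trunc_card_eq_boundD)
  then obtain W where W: "finite W" "W \<subseteq> S'" "card W = card D * T"
    using infinite_arbitrarily_large obtain_subset_with_card_n by metis
  (* W reserves T points for each colour; a colour c other than c0 uses m c of them. *)
  have "card W = card (D \<times> {..<T})" using W by (simp add: card_cartesian_product)
  then obtain h where h: "bij_betw h W (D \<times> {..<T})"
    using W D finite_same_card_bij by (metis finite_SigmaI finite_lessThan)
  have "\<exists>c0\<in>D. trunc_card T {x\<in>S. f x = c0} = T"
  proof (rule ccontr)
    assume "\<not> ?thesis"
    then have sm: "finite {x\<in>S. f x = c} \<and> card {x\<in>S. f x = c} < T" if "c \<in> D" for c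
      using that by (auto simp: trunc_card_def split: if_splits)
    have S: "S = (\<Union>c\<in>D. {x\<in>S. f x = c})" using f by auto
    have "finite (\<Union>c\<in>D. {x\<in>S. f x = c})" using sm D by blast
    then have "finite S" using S by simp
    have "card S \<le> (\<Sum>c\<in>D. card {x\<in>S. f x = c})"
      by (subst S) (rule card_UN_le[OF D(1)])
    also have "\<dots> < (\<Sum>c\<in>D. T)"
      by (rule sum_strict_mono) (use sm D in auto)
    finally show False using False \<open>finite S\<close> by simp
  qed
  then obtain c0 where c0: "c0 \<in> D" "trunc_card T {x\<in>S. f x = c0} = T" by blast
  define m where "m c = trunc_card T {x\<in>S. f x = c}" for c
  have m: "m c \<le> T" for c by (simp add: m_def trunc_card_le)
  define g where "g y = (if y \<in> W \<and> snd (h y) < m (fst (h y)) then fst (h y) else c0)" for y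
  have part: "bij_betw h {y\<in>W. fst (h y) = c \<and> snd (h y) < m c} ({c} \<times> {..<m c})" if "c \<in> D" for c
  proof -
    have "{y\<in>W. fst (h y) = c \<and> snd (h y) < m c} = {y\<in>W. h y \<in> {c} \<times> {..<m c}}"
      by (auto simp: mem_Times_iff)
    moreover have "h ` {y\<in>W. h y \<in> Z} = h ` W \<inter> Z" for Z by auto
    ultimately have "h ` {y\<in>W. fst (h y) = c \<and> snd (h y) < m c} = h ` W \<inter> {c} \<times> {..<m c}"
      by simp
    also have "\<dots> = {c} \<times> {..<m c}"
      using h m[of c] that by (auto simp: bij_betw_def)
    finally show ?thesis
      using h by (auto simp: bij_betw_def inj_on_def)
  qed
  have cardpart: "card {y\<in>W. fst (h y) = c \<and> snd (h y) < m c} = m c" if "c \<in> D" for c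
    using bij_betw_same_card[OF part[OF that]] by (simp add: card_cartesian_product)
  have gD: "g y \<in> D" for y
  proof -
    have "fst (h y) \<in> D" if "y \<in> W"
      using bij_betwE[OF h] that by (auto simp: mem_Times_iff)
    then show ?thesis using c0 by (auto simp: g_def)
  qed
  have other: "{y\<in>S'. g y = c} = {y\<in>W. fst (h y) = c \<and> snd (h y) < m c}" if "c \<noteq> c0" for c
    using W that by (auto simp: g_def)
  have "trunc_card T {y\<in>S'. g y = c} = m c" if "c \<in> D" for c
  proof (cases "c = c0")
    case True
    have "{y\<in>W. fst (h y) = c0 \<and> snd (h y) < m c0} \<subseteq> {y\<in>S'. g y = c0}"
      using W by (auto simp: g_def)
    then have "trunc_card T {y\<in>S'. g y = c0} = T"
      by (rule trunc_card_eq_bound[rotated]) (use cardpart[OF c0(1)] c0(2) W(1) in \<open>auto simp: m_def\<close>)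
    then show ?thesis using c0(2) True by (simp add: m_def)
  next
    case False
    show ?thesis
      unfolding other[OF False] using cardpart[OF that] m[of c] W(1) by (simp add: trunc_card_def)
  qed
  moreover have "finite {y\<in>S'. g y = c}" if "c \<noteq> c0" for c
    unfolding other[OF that] using W(1) by simp
  ultimately show ?thesis using gD c0(1) by (intro exI[of _ g] bexI[of _ c0]) (auto simp: m_def)
qed

lemma clopenin_isolated_singleton:
  assumes "totally_separated_space X" "x \<in> isolated_points X"
  shows "clopenin X {x}"
proof -
  have "openin X (topspace X - {x})"
  proof (subst openin_subopen, intro ballI)
    fix y assume y: "y \<in> topspace X - {x}"
    then obtain K where "clopenin X K" "y \<in> K" "x \<notin> K"
      using assms by (auto simp: totally_separated_space_def isolated_points_def)
    then show "\<exists>T. openin X T \<and> y \<in> T \<and> T \<subseteq> topspace X - {x}"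
      using clopenin_subset by (intro exI[of _ K]) (auto simp: clopenin_def)
  qed
  then show ?thesis
    using assms by (auto simp: clopenin_def closedin_def isolated_points_def)
qed

lemma clopenin_finite_isolated:
  assumes "totally_separated_space X" "finite S" "S \<subseteq> isolated_points X"
  shows "clopenin X S"
proof -
  have s: "clopenin X {x}" if "x \<in> S" for x
    using that assms(1,3) by (intro clopenin_isolated_singleton) auto
  have "openin X (\<Union>((\<lambda>x. {x}) ` S))"
    by (rule openin_Union) (use s in \<open>auto simp: clopenin_def\<close>)
  moreover have "closedin X (\<Union>((\<lambda>x. {x}) ` S))"
    by (rule closedin_Union) (use s assms(2) in \<open>auto simp: clopenin_def\<close>)
  ultimately show ?thesis by (simp add: clopenin_def)
qed

text \<open>
  A nonempty clopen set without isolated points has two points, so a clopen set cuts it in two; each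
  half is again of this kind.
\<close>

lemma perfect_clopen_colouring:
  assumes X: "totally_separated_space X" and R: "finite R" "R \<noteq> {}"
    and H: "clopenin X H" "H \<noteq> {}" "H \<inter> isolated_points X = {}"
  shows "\<exists>b. locally_constant X b \<and> range b \<subseteq> R \<and> R \<subseteq> b ` H"
  using R H
proof (induction R arbitrary: H rule: finite_ne_induct)
  case (singleton c)
  then show ?case by (intro exI[of _ "\<lambda>_. c"]) (auto simp: locally_constant_const)
next
  case (insert c R)
  then obtain x where x: "x \<in> H" by auto
  have "H \<noteq> {x}"
    using insert.prems by (auto simp: isolated_points_def clopenin_def dest: openin_subset)
  then obtain y where y: "y \<in> H" "y \<noteq> x" using x by auto
  have "x \<in> topspace X" "y \<in> topspace X"
    using x y clopenin_subset[OF insert.prems(1)] by auto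
  then obtain K where K: "clopenin X K" "x \<in> K" "y \<notin> K"
    using X y(2) unfolding totally_separated_space_def by metis
  have "clopenin X (H - K)" "H - K \<noteq> {}" "(H - K) \<inter> isolated_points X = {}"
    using y K insert.prems by (auto intro: clopenin_Diff)
  then obtain b where b: "locally_constant X b" "range b \<subseteq> R" "R \<subseteq> b ` (H - K)"
    using insert.IH by blast
  have "locally_constant X (\<lambda>x. if x \<in> K then c else b x)"
    by (intro locally_constant_if K b locally_constant_const)
  moreover have "insert c R \<subseteq> (\<lambda>x. if x \<in> K then c else b x) ` H"
  proof
    fix d assume d: "d \<in> insert c R"
    show "d \<in> (\<lambda>x. if x \<in> K then c else b x) ` H"
    proof (cases "d = c")
      case True
      then show ?thesis using x K by (intro image_eqI[of _ _ x]) auto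
    next
      case False
      then obtain z where "z \<in> H - K" "d = b z" using d b by auto
      then show ?thesis by (intro image_eqI[of _ _ z]) auto
    qed
  qed
  ultimately show ?case using b(2) by (intro exI[of _ "\<lambda>x. if x \<in> K then c else b x"]) auto
qed

text \<open>
  The condition on the closure says that the space is the sum of a space with dense isolated points and
  a space without isolated points. In terms of the Boolean algebra of clopen sets: it is the product of
  an atomic and an atomless algebra.
\<close>

definition tame_space :: "'a topology \<Rightarrow> bool" where
  "tame_space X \<longleftrightarrow> compact_space X \<and> totally_separated_space X \<and>
     openin X (X closure_of isolated_points X)"

text \<open>
  The invariants of a clopen set that matter when few moves of the game are left: the number of its
  isolated points up to a threshold, and whether it reaches into the perfect part.
\<close>

definition similar :: "'a topology \<Rightarrow> 'b topology \<Rightarrow> nat \<Rightarrow> 'a set \<Rightarrow> 'b set \<Rightarrow> bool" where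
  "similar X Y T F G \<longleftrightarrow>
     trunc_card T (F \<inter> isolated_points X) = trunc_card T (G \<inter> isolated_points Y) \<and>
     (F \<subseteq> X closure_of isolated_points X \<longleftrightarrow> G \<subseteq> Y closure_of isolated_points Y)"

lemma similar_commute: "similar X Y T F G \<longleftrightarrow> similar Y X T G F"
  unfolding similar_def by argo

lemma similar_empty: "similar X Y T {} {}"
  by (simp add: similar_def trunc_card_def)

lemma tame_closure_clopen: "tame_space X \<Longrightarrow> clopenin X (X closure_of isolated_points X)"
  by (simp add: tame_space_def clopenin_def)

text \<open>
  Inside the atomic part, having no isolated point means being empty. Hence similarity with any positive
  threshold preserves emptiness.
\<close>

lemma open_in_closure_eq_empty:
  assumes "openin X F" "F \<subseteq> X closure_of isolated_points X" "F \<inter> isolated_points X = {}"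
  shows "F = {}"
proof -
  have "F \<inter> X closure_of isolated_points X = {}"
    by (subst openin_Int_closure_of_eq_empty[OF assms(1)]) (rule assms(3))
  then show ?thesis using assms(2) by blast
qed

lemma similar_imp_empty_iff:
  assumes "similar X Y T F G" "T > 0" "clopenin X F" "clopenin Y G"
  shows "F = {} \<longleftrightarrow> G = {}"
proof -
  have "F = {} \<longleftrightarrow> F \<subseteq> X closure_of isolated_points X \<and> F \<inter> isolated_points X = {}"
    using open_in_closure_eq_empty[of X F] assms(3) unfolding clopenin_def by blast
  moreover have "G = {} \<longleftrightarrow> G \<subseteq> Y closure_of isolated_points Y \<and> G \<inter> isolated_points Y = {}"
    using open_in_closure_eq_empty[of Y G] assms(4) unfolding clopenin_def by blast
  ultimately show ?thesis
    using assms(1) trunc_card_eq_0_iff[OF assms(2), of "F \<inter> isolated_points X"]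
      trunc_card_eq_0_iff[OF assms(2), of "G \<inter> isolated_points Y"]
    unfolding similar_def by argo
qed

text \<open>
  The answer to a move. The isolated points of \<open>F\<close> and \<open>G\<close> are treated by \<open>match_colouring\<close>, whose
  default colour \<open>c0\<close> is also given to the non-isolated points in the closure of the isolated ones. The
  perfect part of \<open>G\<close> can be cut into as many nonempty clopen pieces as the perfect part of \<open>F\<close>
  has colours.
\<close>

lemma similar_split:
  assumes X: "tame_space X" and Y: "tame_space Y" and D: "finite D" "D \<noteq> {}"
    and F: "clopenin X F" and G: "clopenin Y G" and sim: "similar X Y (card D * T) F G"
    and d: "locally_constant X d" "\<And>x. x \<in> topspace X \<Longrightarrow> d x \<in> D"
  shows "\<exists>b. locally_constant Y b \<and> (\<forall>y. b y \<in> D) \<and>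
    (\<forall>c\<in>D. similar X Y T {x\<in>F. d x = c} {y\<in>G. b y = c})"
proof -
  let ?I = "isolated_points X" and ?J = "isolated_points Y"
  let ?A = "X closure_of ?I" and ?B = "Y closure_of ?J"
  have A: "clopenin X ?A" and B: "clopenin Y ?B" using X Y tame_closure_clopen by auto
  have tsY: "totally_separated_space Y" using Y by (simp add: tame_space_def)
  have JB: "?J \<subseteq> ?B"
    by (auto intro!: closure_of_subset simp: isolated_points_def)
  have subF: "F \<subseteq> topspace X" using F clopenin_subset by auto
  have "\<exists>g. \<exists>c0\<in>D. (\<forall>y\<in>G \<inter> ?J. g y \<in> D) \<and>
      (\<forall>c\<in>D. trunc_card T {x\<in>F \<inter> ?I. d x = c} = trunc_card T {y\<in>G \<inter> ?J. g y = c}) \<and>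
      (\<forall>c\<in>D. c \<noteq> c0 \<longrightarrow> finite {y\<in>G \<inter> ?J. g y = c})"
    by (rule match_colouring[OF D]) (use sim d subF in \<open>auto simp: similar_def\<close>)
  then obtain g c0 where c0: "c0 \<in> D" and gD: "\<forall>y\<in>G \<inter> ?J. g y \<in> D"
    and gtr: "\<forall>c\<in>D. trunc_card T {x\<in>F \<inter> ?I. d x = c} = trunc_card T {y\<in>G \<inter> ?J. g y = c}"
    and gfin: "\<forall>c\<in>D. c \<noteq> c0 \<longrightarrow> finite {y\<in>G \<inter> ?J. g y = c}" by blast
  let ?W = "\<Union>c\<in>D - {c0}. {y\<in>G \<inter> ?J. g y = c}"
  define b1 where "b1 y = (if y \<in> ?W then g y else c0)" for y
  have W: "finite ?W" using D(1) gfin by auto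
  have b1: "locally_constant Y b1"
    unfolding locally_constant_def
  proof
    fix c
    show "openin Y {y \<in> topspace Y. b1 y = c}"
    proof (cases "c = c0")
      case True
      have "{y \<in> topspace Y. b1 y = c} = topspace Y - ?W" using True by (auto simp: b1_def)
      moreover have "clopenin Y ?W" by (rule clopenin_finite_isolated[OF tsY W]) auto
      ultimately show ?thesis by (simp add: clopenin_def openin_diff)
    next
      case False
      have "{y \<in> topspace Y. b1 y = c} = {y \<in> ?W. g y = c}"
        using False by (auto simp: b1_def isolated_points_def)
      moreover have "clopenin Y {y \<in> ?W. g y = c}"
        by (rule clopenin_finite_isolated[OF tsY finite_subset[OF _ W]]) auto
      ultimately show ?thesis by (simp add: clopenin_def)
    qed
  qed
  have b1D: "b1 y \<in> D" for y using c0 by (auto simp: b1_def)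
  have b1g: "b1 y = g y" if "y \<in> G \<inter> ?J" for y
    using gD that by (auto simp: b1_def)
  define R where "R = d ` (F - ?A)"
  have R: "R \<subseteq> D" "finite R"
    using d subF D(1) finite_subset[of R D] unfolding R_def by auto
  have RG: "F - ?A = {} \<longleftrightarrow> G - ?B = {}"
    using sim by (auto simp: similar_def)
  have "\<exists>b. locally_constant Y b \<and> range b \<subseteq> D \<and> b ` (G - ?B) = R"
  proof (cases "R = {}")
    case True
    then have "G - ?B = {}" using RG by (simp add: R_def)
    then have "(\<lambda>_. c0) ` (G - ?B) = R" unfolding True by (simp only: image_empty)
    then show ?thesis
      using c0 by (intro exI[of _ "\<lambda>_. c0"]) (auto simp: locally_constant_const)
  next
    case False
    then have "G - ?B \<noteq> {}" using RG by (auto simp: R_def)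
    then obtain b where "locally_constant Y b" "range b \<subseteq> R" "R \<subseteq> b ` (G - ?B)"
      using perfect_clopen_colouring[OF tsY R(2) False clopenin_Diff[OF G B]] JB by blast
    then show ?thesis using R(1) by blast
  qed
  then obtain b2 where b2: "locally_constant Y b2" "range b2 \<subseteq> D" "b2 ` (G - ?B) = R" by blast
  define b where "b y = (if y \<in> ?B then b1 y else b2 y)" for y
  have "locally_constant Y b"
    unfolding b_def by (rule locally_constant_if[OF B b1 b2(1)])
  moreover have "\<forall>y. b y \<in> D" using b1D b2(2) by (auto simp: b_def)
  moreover have "similar X Y T {x\<in>F. d x = c} {y\<in>G. b y = c}" if c: "c \<in> D" for c
  proof -
    have "{x\<in>F. d x = c} \<inter> ?I = {x\<in>F \<inter> ?I. d x = c}" by auto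
    moreover have "{y\<in>G. b y = c} \<inter> ?J = {y\<in>G \<inter> ?J. g y = c}"
      using b1g JB by (auto simp: b_def)
    moreover have "{x\<in>F. d x = c} \<subseteq> ?A \<longleftrightarrow> c \<notin> R" by (auto simp: R_def)
    moreover have "{y\<in>G. b y = c} \<subseteq> ?B \<longleftrightarrow> c \<notin> R"
      unfolding b2(3)[symmetric] by (auto simp: b_def)
    ultimately show ?thesis using gtr c by (simp add: similar_def)
  qed
  ultimately show ?thesis by blast
qed


section \<open>Values of formulas in \<open>C(X)\<close>\<close>

primrec poly_eval :: "star_poly \<Rightarrow> (nat \<Rightarrow> complex) \<Rightarrow> complex" where
  "poly_eval (P_Var i) v = v i"
| "poly_eval P_One v = 1"
| "poly_eval (P_Add p q) v = poly_eval p v + poly_eval q v"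
| "poly_eval (P_Mult p q) v = poly_eval p v * poly_eval q v"
| "poly_eval (P_Scale c p) v = c * poly_eval p v"
| "poly_eval (P_Star p) v = cnj (poly_eval p v)"

text \<open>
  Evaluation of a *-polynomial in \<open>C(X)\<close> is pointwise, so it reduces to the complex numbers.
\<close>

lemma poly_val_C_alg:
  assumes "\<And>i. s i \<in> extensional (topspace X)"
  shows "poly_val (C_alg X) s P = (\<lambda>x\<in>topspace X. poly_eval P (\<lambda>i. s i x))"
  using extensional_restrict[OF assms]
  by (induction P) (simp_all add: C_alg_def restrict_def fun_eq_iff)

lemma poly_eval_bounded:
  "\<exists>B\<ge>0. \<forall>v. (\<forall>i. cmod (v i) \<le> 1) \<longrightarrow> cmod (poly_eval P v) \<le> B"
proof (induction P)
  case (P_Var i)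
  show ?case by (intro exI[of _ 1]) auto
next
  case P_One
  show ?case by (intro exI[of _ 1]) auto
next
  case (P_Add P Q)
  then obtain B C where "B \<ge> 0" "\<forall>v. (\<forall>i. cmod (v i) \<le> 1) \<longrightarrow> cmod (poly_eval P v) \<le> B"
    "C \<ge> 0" "\<forall>v. (\<forall>i. cmod (v i) \<le> 1) \<longrightarrow> cmod (poly_eval Q v) \<le> C" by blast
  then show ?case
    by (intro exI[of _ "B + C"]) (auto intro!: norm_triangle_mono)
next
  case (P_Mult P Q)
  then obtain B C where "B \<ge> 0" "\<forall>v. (\<forall>i. cmod (v i) \<le> 1) \<longrightarrow> cmod (poly_eval P v) \<le> B"
    "C \<ge> 0" "\<forall>v. (\<forall>i. cmod (v i) \<le> 1) \<longrightarrow> cmod (poly_eval Q v) \<le> C" by blast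
  then show ?case
    by (intro exI[of _ "B * C"]) (auto simp: norm_mult intro!: mult_mono)
next
  case (P_Scale c P)
  then obtain B where "B \<ge> 0" "\<forall>v. (\<forall>i. cmod (v i) \<le> 1) \<longrightarrow> cmod (poly_eval P v) \<le> B" by blast
  then show ?case
    by (intro exI[of _ "cmod c * B"]) (auto simp: norm_mult intro!: mult_left_mono)
next
  case (P_Star P)
  then show ?case by simp
qed

lemma poly_eval_lipschitz:
  "\<exists>L\<ge>0. \<forall>v w e. (\<forall>i. cmod (v i) \<le> 1) \<and> (\<forall>i. cmod (w i) \<le> 1) \<and> (\<forall>i. cmod (v i - w i) \<le> e) \<longrightarrow>
     cmod (poly_eval P v - poly_eval P w) \<le> L * e"
proof (induction P)
  case (P_Var i)
  show ?case by (intro exI[of _ 1]) auto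
next
  case P_One
  show ?case by (intro exI[of _ 0]) auto
next
  case (P_Add P Q)
  then obtain L M where L: "L \<ge> 0" "\<And>v w e. (\<forall>i. cmod (v i) \<le> 1) \<and> (\<forall>i. cmod (w i) \<le> 1) \<and>
      (\<forall>i. cmod (v i - w i) \<le> e) \<Longrightarrow> cmod (poly_eval P v - poly_eval P w) \<le> L * e"
    and M: "M \<ge> 0" "\<And>v w e. (\<forall>i. cmod (v i) \<le> 1) \<and> (\<forall>i. cmod (w i) \<le> 1) \<and>
      (\<forall>i. cmod (v i - w i) \<le> e) \<Longrightarrow> cmod (poly_eval Q v - poly_eval Q w) \<le> M * e" by blast
  show ?case
  proof (intro exI[of _ "L + M"] conjI allI impI)
    fix v w :: "nat \<Rightarrow> complex" and e
    assume "(\<forall>i. cmod (v i) \<le> 1) \<and> (\<forall>i. cmod (w i) \<le> 1) \<and> (\<forall>i. cmod (v i - w i) \<le> e)"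
    from L(2)[OF this] M(2)[OF this]
    show "cmod (poly_eval (P_Add P Q) v - poly_eval (P_Add P Q) w) \<le> (L + M) * e"
      using norm_triangle_mono[of "poly_eval P v - poly_eval P w" "L * e"
          "poly_eval Q v - poly_eval Q w" "M * e"]
      by (simp add: algebra_simps)
  qed (use L M in auto)
next
  case (P_Mult P Q)
  then obtain L M where L: "L \<ge> 0" "\<And>v w e. (\<forall>i. cmod (v i) \<le> 1) \<and> (\<forall>i. cmod (w i) \<le> 1) \<and>
      (\<forall>i. cmod (v i - w i) \<le> e) \<Longrightarrow> cmod (poly_eval P v - poly_eval P w) \<le> L * e"
    and M: "M \<ge> 0" "\<And>v w e. (\<forall>i. cmod (v i) \<le> 1) \<and> (\<forall>i. cmod (w i) \<le> 1) \<and>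
      (\<forall>i. cmod (v i - w i) \<le> e) \<Longrightarrow> cmod (poly_eval Q v - poly_eval Q w) \<le> M * e" by blast
  obtain B where B: "B \<ge> 0" "\<And>v. \<forall>i. cmod (v i) \<le> 1 \<Longrightarrow> cmod (poly_eval P v) \<le> B"
    using poly_eval_bounded by blast
  obtain C where C: "C \<ge> 0" "\<And>v. \<forall>i. cmod (v i) \<le> 1 \<Longrightarrow> cmod (poly_eval Q v) \<le> C"
    using poly_eval_bounded by blast
  show ?case
  proof (intro exI[of _ "L * C + B * M"] conjI allI impI)
    fix v w :: "nat \<Rightarrow> complex" and e
    assume vw: "(\<forall>i. cmod (v i) \<le> 1) \<and> (\<forall>i. cmod (w i) \<le> 1) \<and> (\<forall>i. cmod (v i - w i) \<le> e)"
    then have "0 \<le> e" using norm_ge_zero order_trans by blast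
    have "poly_eval (P_Mult P Q) v - poly_eval (P_Mult P Q) w =
        (poly_eval P v - poly_eval P w) * poly_eval Q v + poly_eval P w * (poly_eval Q v - poly_eval Q w)"
      by (simp add: algebra_simps)
    also have "cmod \<dots> \<le> L * e * C + B * (M * e)"
      using L M B C vw \<open>0 \<le> e\<close>
      by (intro norm_triangle_mono) (auto simp: norm_mult intro!: mult_mono)
    finally show "cmod (poly_eval (P_Mult P Q) v - poly_eval (P_Mult P Q) w) \<le> (L * C + B * M) * e"
      by (simp add: algebra_simps)
  qed (use L M B C in auto)
next
  case (P_Scale c P)
  then obtain L where L: "L \<ge> 0" "\<And>v w e. (\<forall>i. cmod (v i) \<le> 1) \<and> (\<forall>i. cmod (w i) \<le> 1) \<and>
      (\<forall>i. cmod (v i - w i) \<le> e) \<Longrightarrow> cmod (poly_eval P v - poly_eval P w) \<le> L * e" by blast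
  show ?case
  proof (intro exI[of _ "cmod c * L"] conjI allI impI)
    fix v w :: "nat \<Rightarrow> complex" and e
    assume "(\<forall>i. cmod (v i) \<le> 1) \<and> (\<forall>i. cmod (w i) \<le> 1) \<and> (\<forall>i. cmod (v i - w i) \<le> e)"
    from mult_left_mono[OF L(2)[OF this], of "cmod c"]
    show "cmod (poly_eval (P_Scale c P) v - poly_eval (P_Scale c P) w) \<le> cmod c * L * e"
      by (simp add: norm_mult flip: right_diff_distrib)
  qed (use L in auto)
next
  case (P_Star P)
  have "cmod (cnj a - cnj b) = cmod (a - b)" for a b
    by (metis complex_cnj_diff complex_mod_cnj)
  then show ?case using P_Star by simp
qed

lemma unit_ball_C_alg:
  assumes "compact_space X"
  shows "unit_ball (C_alg X) =
    {f \<in> extensional (topspace X). continuous_map X euclidean f \<and> (\<forall>x\<in>topspace X. cmod (f x) \<le> 1)}"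
proof -
  have "Sup (insert 0 ((\<lambda>x. cmod (f x)) ` topspace X)) \<le> 1 \<longleftrightarrow> (\<forall>x\<in>topspace X. cmod (f x) \<le> 1)"
    if f: "continuous_map X euclidean f" for f :: "'a \<Rightarrow> complex"
  proof -
    have "compactin euclidean (f ` topspace X)"
      using image_compactin[OF _ f] assms by (simp add: compact_space_def)
    then have "bounded (f ` topspace X)" by (simp add: compact_imp_bounded)
    then obtain M where "\<forall>x\<in>topspace X. cmod (f x) \<le> M" by (auto simp: bounded_iff)
    then have "bdd_above (insert 0 ((\<lambda>x. cmod (f x)) ` topspace X))"
      by (intro bdd_aboveI[of _ "max 0 M"]) (auto simp: le_max_iff_disj)
    then show ?thesis by (subst cSup_le_iff) auto
  qed
  then show ?thesis by (auto simp: unit_ball_def C_alg_def)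
qed

lemma cl_val_Norm:
  assumes "compact_space X" "\<And>i. s i \<in> unit_ball (C_alg X)"
  shows "cl_val (C_alg X) s (Norm P) =
    Sup (insert 0 ((\<lambda>x. cmod (poly_eval P (\<lambda>i. s i x))) ` topspace X))"
proof -
  have "poly_val (C_alg X) s P = (\<lambda>x\<in>topspace X. poly_eval P (\<lambda>i. s i x))"
    using assms by (intro poly_val_C_alg) (auto simp: unit_ball_C_alg)
  then show ?thesis by (simp add: C_alg_def cong: image_cong_simp)
qed

lemma cl_val_Conn:
  "cl_val A s (Conn u \<phi>s) = u (\<lambda>i. if i < length \<phi>s then cl_val A s (\<phi>s ! i) else 0)"
proof -
  have "(\<lambda>i. if i < length \<phi>s then map (cl_val A s) \<phi>s ! i else 0) =
      (\<lambda>i. if i < length \<phi>s then cl_val A s (\<phi>s ! i) else 0)" by auto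
  then show ?thesis by (simp only: cl_val.simps)
qed

text \<open>
  Subformulas have bounded values, so a connective is only evaluated on a compact box. There it is bounded
  and uniformly continuous; the latter is read off from the product metric on sequences.
\<close>

lemma connective_on_box:
  fixes B :: real
  assumes u: "continuous_map (Euclidean_space n) euclideanreal u"
  defines "K \<equiv> {v. (\<forall>i<n. \<bar>v i\<bar> \<le> B) \<and> (\<forall>i\<ge>n. v i = 0)}"
  shows connective_bounded: "\<exists>C. \<forall>v\<in>K. \<bar>u v\<bar> \<le> C"
    and connective_uniformly_continuous: "\<epsilon> > 0 \<Longrightarrow> \<exists>\<eta>>0. \<forall>v\<in>K. \<forall>w\<in>K. (\<forall>i<n. \<bar>v i - w i\<bar> \<le> \<eta>) \<longrightarrow> \<bar>u v - u w\<bar> \<le> \<epsilon>"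
proof -
  have K: "K = PiE UNIV (\<lambda>i. if i < n then {-B..B} else {0})"
  proof (intro equalityI subsetI)
    fix v assume "v \<in> K"
    then have "v i \<in> (if i < n then {-B..B} else {0})" for i
      by (cases "i < n") (auto simp: K_def abs_le_iff)
    then show "v \<in> PiE UNIV (\<lambda>i. if i < n then {-B..B} else {0})" by (simp add: PiE_UNIV_domain Pi_iff)
  next
    fix v assume "v \<in> PiE UNIV (\<lambda>i. if i < n then {-B..B} else {0})"
    then have v: "v i \<in> (if i < n then {-B..B} else {0})" for i by (simp add: PiE_UNIV_domain Pi_iff)
    have "\<bar>v i\<bar> \<le> B" if "i < n" for i using v[of i] that by (simp add: abs_le_iff)
    moreover have "v i = 0" if "i \<ge> n" for i using v[of i] that by simp
    ultimately show "v \<in> K" by (simp add: K_def)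
  qed
  have "compactin (product_topology (\<lambda>_. euclideanreal) UNIV) K"
    unfolding K by (subst compactin_PiE) auto
  then have cK: "compact K" by (simp add: euclidean_product_topology)
  have "K \<subseteq> {x. \<forall>i\<ge>n. x i = 0}" by (auto simp: K_def)
  moreover have "continuous_on {x. \<forall>i\<ge>n. x i = 0} u"
    using u by (simp add: Euclidean_space_def euclidean_product_topology)
  ultimately have ct: "continuous_on K u" by (rule continuous_on_subset[rotated])
  show "\<exists>C. \<forall>v\<in>K. \<bar>u v\<bar> \<le> C"
    using compact_imp_bounded[OF compact_continuous_image[OF ct cK]] by (auto simp: bounded_iff)
  show "\<exists>\<eta>>0. \<forall>v\<in>K. \<forall>w\<in>K. (\<forall>i<n. \<bar>v i - w i\<bar> \<le> \<eta>) \<longrightarrow> \<bar>u v - u w\<bar> \<le> \<epsilon>" if \<epsilon>: "\<epsilon> > 0"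
  proof -
    obtain \<delta> where \<delta>: "\<delta> > 0" "\<And>v w. v \<in> K \<Longrightarrow> w \<in> K \<Longrightarrow> dist w v < \<delta> \<Longrightarrow> dist (u w) (u v) < \<epsilon>"
      using compact_uniformly_continuous[OF ct cK] \<epsilon> unfolding uniformly_continuous_on_def by blast
    (* The product metric is at most twice the largest difference of coordinates plus (1/2)^N. *)
    obtain N where N: "(1/2)^N < \<delta>/2"
      using real_arch_pow_inv[of "\<delta>/2" "1/2"] \<delta>(1) by auto
    have "\<bar>u v - u w\<bar> \<le> \<epsilon>" if v: "v \<in> K" and w: "w \<in> K" and vw: "\<forall>i<n. \<bar>v i - w i\<bar> \<le> \<delta>/8" for v w
    proof -
      have "dist (v i) (w i) \<le> \<delta>/8" for i
        using v w vw \<delta>(1) by (cases "i < n") (auto simp: K_def dist_real_def)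
      then have "Max {dist (v (from_nat i)) (w (from_nat i)) |i. i \<le> N} \<le> \<delta>/8"
        by (subst Max_le_iff) auto
      then have "dist v w < \<delta>"
        using dist_fun_le_dist_first_terms[of v w N] N \<delta>(1) by linarith
      then show ?thesis using \<delta>(2)[OF w v] by (simp add: dist_real_def)
    qed
    then show ?thesis using \<delta>(1) by (intro exI[of _ "\<delta>/8"]) auto
  qed
qed

lemma zero_mem_unit_ball: "compact_space X \<Longrightarrow> \<zero>\<^bsub>C_alg X\<^esub> \<in> unit_ball (C_alg X)"
  by (auto simp: unit_ball_C_alg) (auto simp: C_alg_def intro: continuous_map_eq[of _ _ "\<lambda>_. 0"])

text \<open>
  Boundedness is what gives the suprema and infima over the unit ball their meaning.
\<close>

lemma cl_val_bounded:
  assumes X: "compact_space X"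
  shows "wf_formula \<phi> \<Longrightarrow> \<exists>B. \<forall>s. (\<forall>i. s i \<in> unit_ball (C_alg X)) \<longrightarrow> \<bar>cl_val (C_alg X) s \<phi>\<bar> \<le> B"
proof (induction \<phi>)
  case (Norm P)
  obtain B where B: "B \<ge> 0" "\<And>v. \<forall>i. cmod (v i) \<le> 1 \<Longrightarrow> cmod (poly_eval P v) \<le> B"
    using poly_eval_bounded by blast
  have "\<bar>cl_val (C_alg X) s (Norm P)\<bar> \<le> B" if s: "\<forall>i. s i \<in> unit_ball (C_alg X)" for s
    unfolding cl_val_Norm[OF X s[rule_format]]
  proof (rule cSup_abs_le)
    fix r assume "r \<in> insert 0 ((\<lambda>x. cmod (poly_eval P (\<lambda>i. s i x))) ` topspace X)"
    then show "\<bar>r\<bar> \<le> B" using B s by (auto simp: unit_ball_C_alg[OF X])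
  qed simp
  then show ?case by blast
next
  case (Conn u \<phi>s)
  have "\<forall>\<phi>\<in>set \<phi>s. \<exists>B. \<forall>s. (\<forall>i. s i \<in> unit_ball (C_alg X)) \<longrightarrow> \<bar>cl_val (C_alg X) s \<phi>\<bar> \<le> B"
    using Conn.IH Conn.prems by auto
  then obtain B where B: "\<And>\<phi> s. \<phi> \<in> set \<phi>s \<Longrightarrow> \<forall>i. s i \<in> unit_ball (C_alg X) \<Longrightarrow>
      \<bar>cl_val (C_alg X) s \<phi>\<bar> \<le> B \<phi>" by metis
  have "B \<phi> \<le> Max (insert 0 (B ` set \<phi>s))" if "\<phi> \<in> set \<phi>s" for \<phi>
    using that by (intro Max_ge) auto
  then have B': "\<bar>cl_val (C_alg X) s \<phi>\<bar> \<le> Max (insert 0 (B ` set \<phi>s))"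
    if "\<phi> \<in> set \<phi>s" "\<forall>i. s i \<in> unit_ball (C_alg X)" for \<phi> s
    using B[OF that] that by (meson order_trans)
  have "continuous_map (Euclidean_space (length \<phi>s)) euclideanreal u" using Conn.prems by simp
  from connective_bounded[OF this, of "Max (insert 0 (B ` set \<phi>s))"]
  obtain C where C: "\<And>v. (\<forall>i<length \<phi>s. \<bar>v i\<bar> \<le> Max (insert 0 (B ` set \<phi>s))) \<Longrightarrow>
      (\<forall>i\<ge>length \<phi>s. v i = 0) \<Longrightarrow> \<bar>u v\<bar> \<le> C" by blast
  show ?case
    unfolding cl_val_Conn by (intro exI[of _ C] allI impI C) (use B' in auto)
next
  case (SupBall i \<phi>)
  then obtain B where B: "\<And>s. \<forall>i. s i \<in> unit_ball (C_alg X) \<Longrightarrow> \<bar>cl_val (C_alg X) s \<phi>\<bar> \<le> B" by auto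
  have "\<bar>cl_val (C_alg X) s (SupBall i \<phi>)\<bar> \<le> B" if "\<forall>i. s i \<in> unit_ball (C_alg X)" for s
    unfolding cl_val.simps
    by (rule cSup_abs_le) (use B that zero_mem_unit_ball[OF X] in auto)
  then show ?case by blast
next
  case (InfBall i \<phi>)
  then obtain B where B: "\<And>s. \<forall>i. s i \<in> unit_ball (C_alg X) \<Longrightarrow> \<bar>cl_val (C_alg X) s \<phi>\<bar> \<le> B" by auto
  have "\<bar>cl_val (C_alg X) s (InfBall i \<phi>)\<bar> \<le> B" if "\<forall>i. s i \<in> unit_ball (C_alg X)" for s
    unfolding cl_val.simps
    by (rule cInf_abs_ge) (use B that zero_mem_unit_ball[OF X] in auto)
  then show ?case by blast
qed


section \<open>The back-and-forth game\<close>

definition unit_disc_net :: "real \<Rightarrow> complex set \<Rightarrow> bool" where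
  "unit_disc_net \<delta> D \<longleftrightarrow> finite D \<and> D \<subseteq> cball 0 1 \<and> (\<forall>z\<in>cball 0 1. \<exists>c\<in>D. dist z c < \<delta>)"

lemma unit_disc_net_exists:
  assumes "\<delta> > 0"
  shows "\<exists>D. unit_disc_net \<delta> D"
proof -
  obtain D where "finite D" "D \<subseteq> cball (0::complex) 1" "cball 0 1 \<subseteq> (\<Union>c\<in>D. ball c \<delta>)"
    using compactE_image[OF compact_cball[of "0::complex" 1], of "cball 0 1" "\<lambda>c. ball c \<delta>"] assms
    by (metis UN_I centre_in_ball open_ball subsetI)
  then have "unit_disc_net \<delta> D"
    unfolding unit_disc_net_def by (auto simp: dist_commute subset_iff)
  then show ?thesis by blast
qed

lemma unit_disc_net_nonempty: "unit_disc_net \<delta> D \<Longrightarrow> D \<noteq> {}"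
  unfolding unit_disc_net_def by (metis empty_iff mem_cball zero_le_one dist_self)

definition fibre :: "'a topology \<Rightarrow> ('a \<Rightarrow> 'c) \<Rightarrow> 'c \<Rightarrow> 'a set" where
  "fibre X p l = {x \<in> topspace X. p x = l}"

text \<open>
  A position of the game with \<open>k\<close> moves to go. The labels \<open>p\<close> and \<open>q\<close> describe corresponding clopen
  partitions of \<open>X\<close> and \<open>Y\<close>, and \<open>\<sigma>\<close> gives the approximate values that the chosen functions take on
  the pieces. A label is the list of the net points chosen so far. It is kept apart from the current values
  because a quantifier may reuse a variable; overwriting a value must not merge pieces.
\<close>

definition matched ::
  "'a topology \<Rightarrow> 'b topology \<Rightarrow> complex set \<Rightarrow> nat \<Rightarrow> real \<Rightarrow>
   (nat \<Rightarrow> 'a \<Rightarrow> complex) \<Rightarrow> (nat \<Rightarrow> 'b \<Rightarrow> complex) \<Rightarrow> bool" where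
  "matched X Y D k \<delta> s t \<longleftrightarrow>
    (\<exists>p q. \<exists>\<sigma> :: complex list \<Rightarrow> nat \<Rightarrow> complex.
      locally_constant X p \<and> locally_constant Y q \<and>
      (\<forall>l. similar X Y (card D ^ k) (fibre X p l) (fibre Y q l)) \<and>
      (\<forall>i. \<forall>x\<in>topspace X. dist (s i x) (\<sigma> (p x) i) \<le> \<delta>) \<and>
      (\<forall>i. \<forall>y\<in>topspace Y. dist (t i y) (\<sigma> (q y) i) \<le> \<delta>))"

lemma matched_sym: "matched X Y D k \<delta> s t \<Longrightarrow> matched Y X D k \<delta> t s"
  unfolding matched_def by (metis similar_commute)

lemma clopenin_fibre: "locally_constant X p \<Longrightarrow> clopenin X (fibre X p l)"
  using clopenin_locally_constant_preimage[of X p "{l}"] by (simp add: fibre_def)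

lemma matched_point:
  assumes m: "matched X Y D k \<delta> s t" and D: "unit_disc_net \<delta> D" and x: "x \<in> topspace X"
  shows "\<exists>y\<in>topspace Y. \<forall>i. cmod (s i x - t i y) \<le> 2 * \<delta>"
proof -
  obtain p q and \<sigma> :: "complex list \<Rightarrow> nat \<Rightarrow> complex"
    where p: "locally_constant X p" and q: "locally_constant Y q"
      and sim: "\<And>l. similar X Y (card D ^ k) (fibre X p l) (fibre Y q l)"
      and s: "\<And>i x. x \<in> topspace X \<Longrightarrow> dist (s i x) (\<sigma> (p x) i) \<le> \<delta>"
      and t: "\<And>i y. y \<in> topspace Y \<Longrightarrow> dist (t i y) (\<sigma> (q y) i) \<le> \<delta>"
    using m unfolding matched_def by blast
  have "card D ^ k > 0"
    using D unit_disc_net_nonempty[OF D] by (simp add: unit_disc_net_def card_gt_0_iff)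
  then have "fibre X p (p x) = {} \<longleftrightarrow> fibre Y q (p x) = {}"
    using similar_imp_empty_iff[OF sim _ clopenin_fibre[OF p] clopenin_fibre[OF q]] by blast
  moreover have "x \<in> fibre X p (p x)" using x by (simp add: fibre_def)
  ultimately obtain y where y: "y \<in> topspace Y" "q y = p x" by (auto simp: fibre_def)
  have "cmod (s i x - t i y) \<le> 2 * \<delta>" for i
    using s[OF x, of i] t[OF y(1), of i] y(2) dist_triangle_le[of "s i x" "\<sigma> (p x) i" "t i y" "2 * \<delta>"]
    by (simp add: dist_norm norm_minus_commute)
  then show ?thesis using y(1) by blast
qed

text \<open>
  A move \<open>a\<close> is rounded to a function \<open>d\<close> with values in the net, and each piece is cut along the fibres
  of \<open>d\<close>. The answer given by \<open>similar_split\<close>, piece by piece, is a function with values in the net and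
  can be used without rounding.
\<close>

lemma matched_extend:
  assumes X: "tame_space X" and Y: "tame_space Y" and D: "unit_disc_net \<delta> D"
    and m: "matched X Y D (Suc k) \<delta> s t" and a: "a \<in> unit_ball (C_alg X)"
  shows "\<exists>b\<in>unit_ball (C_alg Y). matched X Y D k \<delta> (s(i := a)) (t(i := b))"
proof -
  have cX: "compact_space X" "totally_separated_space X" and cY: "compact_space Y"
    using X Y by (auto simp: tame_space_def)
  have a': "continuous_map X euclidean a" "\<And>x. x \<in> topspace X \<Longrightarrow> cmod (a x) \<le> 1"
    using a by (auto simp: unit_ball_C_alg[OF cX(1)])
  have D': "finite D" "D \<noteq> {}" "D \<subseteq> cball 0 1" "\<And>z. cmod z \<le> 1 \<Longrightarrow> \<exists>c\<in>D. dist z c < \<delta>"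
    using D unit_disc_net_nonempty[OF D] by (auto simp: unit_disc_net_def)
  obtain p q and \<sigma> :: "complex list \<Rightarrow> nat \<Rightarrow> complex"
    where p: "locally_constant X p" and q: "locally_constant Y q"
      and sim: "\<And>l. similar X Y (card D * card D ^ k) (fibre X p l) (fibre Y q l)"
      and s: "\<And>i x. x \<in> topspace X \<Longrightarrow> dist (s i x) (\<sigma> (p x) i) \<le> \<delta>"
      and t: "\<And>i y. y \<in> topspace Y \<Longrightarrow> dist (t i y) (\<sigma> (q y) i) \<le> \<delta>"
    using m unfolding matched_def power_Suc by blast
  obtain d where d: "locally_constant X d"
      "\<And>x. x \<in> topspace X \<Longrightarrow> d x \<in> D" "\<And>x. x \<in> topspace X \<Longrightarrow> dist (a x) (d x) < \<delta>"
    using locally_constant_approximation[OF cX a'(1) D'(4)[OF a'(2)]] by blast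
  have "\<forall>l. \<exists>e. locally_constant Y e \<and> (\<forall>y. e y \<in> D) \<and>
      (\<forall>c\<in>D. similar X Y (card D ^ k) {x\<in>fibre X p l. d x = c} {y\<in>fibre Y q l. e y = c})"
    by (intro allI similar_split[OF X Y D'(1,2) clopenin_fibre[OF p] clopenin_fibre[OF q] sim d(1,2)])
  from choice[OF this]
  obtain e where e: "\<And>l. locally_constant Y (e l)" "\<And>l y. e l y \<in> D"
    "\<And>l c. c \<in> D \<Longrightarrow> similar X Y (card D ^ k) {x\<in>fibre X p l. d x = c} {y\<in>fibre Y q l. e l y = c}"
    by blast
  define f where "f y = e (q y) y" for y
  have f: "locally_constant Y f" unfolding f_def by (rule locally_constant_glue[OF q e(1)])
  have fD: "f y \<in> D" for y by (simp add: f_def e(2))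
  define b where "b = restrict f (topspace Y)"
  have "continuous_map Y euclidean b"
    unfolding b_def using locally_constant_imp_continuous_map[OF f, of euclidean]
    by (auto intro: continuous_map_eq)
  moreover have "cmod (f y) \<le> 1" for y using fD D'(3) by (force simp: subset_iff)
  ultimately have b: "b \<in> unit_ball (C_alg Y)"
    by (auto simp: unit_ball_C_alg[OF cY] b_def)
  define p' where "p' x = d x # p x" for x
  define q' where "q' y = f y # q y" for y
  define \<sigma>' where "\<sigma>' l = (\<sigma> (tl l))(i := hd l)" for l
  have "locally_constant X p'" unfolding p'_def
    by (rule locally_constant_glue[OF d(1), of "\<lambda>c x. c # p x"]) (rule locally_constant_comp[OF p])
  moreover have "locally_constant Y q'" unfolding q'_def
    by (rule locally_constant_glue[OF f, of "\<lambda>c x. c # q x"]) (rule locally_constant_comp[OF q])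
  moreover have "similar X Y (card D ^ k) (fibre X p' l) (fibre Y q' l)" for l
  proof (cases "\<exists>c l'. l = c # l' \<and> c \<in> D")
    case True
    then obtain c l' where l: "l = c # l'" "c \<in> D" by blast
    have "fibre X p' l = {x\<in>fibre X p l'. d x = c}" "fibre Y q' l = {y\<in>fibre Y q l'. e l' y = c}"
      by (auto simp: fibre_def p'_def q'_def f_def l)
    then show ?thesis using e(3)[OF l(2)] by simp
  next
    case False
    then have "fibre X p' l = {}" "fibre Y q' l = {}"
      using d(2) fD by (auto simp: fibre_def p'_def q'_def)
    then show ?thesis by (simp add: similar_empty)
  qed
  moreover have "dist ((s(i := a)) j x) (\<sigma>' (p' x) j) \<le> \<delta>" if "x \<in> topspace X" for j x
    using s[OF that] d(3)[OF that] by (simp add: \<sigma>'_def p'_def)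
  moreover have "dist ((t(i := b)) j y) (\<sigma>' (q' y) j) \<le> \<delta>" if "y \<in> topspace Y" for j y
    using t[OF that] that zero_le_dist[of "t i y" "\<sigma> (q y) i"] order_trans[OF zero_le_dist t[OF that]]
    by (simp add: \<sigma>'_def q'_def b_def)
  ultimately have "matched X Y D k \<delta> (s(i := a)) (t(i := b))"
    unfolding matched_def by blast
  then show ?thesis using b by blast
qed

lemma Sup_close:
  fixes A B :: "real set"
  assumes "A \<noteq> {}" "B \<noteq> {}" "bdd_above A" "bdd_above B"
    and AB: "\<And>a. a \<in> A \<Longrightarrow> \<exists>b\<in>B. \<bar>a - b\<bar> \<le> e" and BA: "\<And>b. b \<in> B \<Longrightarrow> \<exists>a\<in>A. \<bar>a - b\<bar> \<le> e"
  shows "\<bar>Sup A - Sup B\<bar> \<le> e"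
proof -
  have "Sup A \<le> Sup B + e"
    using assms(1)
  proof (rule cSup_least)
    fix a assume "a \<in> A"
    then obtain b where "b \<in> B" "\<bar>a - b\<bar> \<le> e" using AB by blast
    then show "a \<le> Sup B + e" using cSup_upper[OF _ assms(4), of b] by auto
  qed
  moreover have "Sup B \<le> Sup A + e"
    using assms(2)
  proof (rule cSup_least)
    fix b assume "b \<in> B"
    then obtain a where "a \<in> A" "\<bar>a - b\<bar> \<le> e" using BA by blast
    then show "b \<le> Sup A + e" using cSup_upper[OF _ assms(3), of a] by auto
  qed
  ultimately show ?thesis by auto
qed

lemma Inf_close:
  fixes A B :: "real set"
  assumes "A \<noteq> {}" "B \<noteq> {}" "bdd_below A" "bdd_below B"
    and AB: "\<And>a. a \<in> A \<Longrightarrow> \<exists>b\<in>B. \<bar>a - b\<bar> \<le> e" and BA: "\<And>b. b \<in> B \<Longrightarrow> \<exists>a\<in>A. \<bar>a - b\<bar> \<le> e"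
  shows "\<bar>Inf A - Inf B\<bar> \<le> e"
proof -
  have "\<bar>Sup (uminus ` A) - Sup (uminus ` B)\<bar> \<le> e"
  proof (rule Sup_close)
    show "\<exists>b\<in>uminus ` B. \<bar>a - b\<bar> \<le> e" if "a \<in> uminus ` A" for a
      using AB that by (force simp: abs_minus_commute)
    show "\<exists>a\<in>uminus ` A. \<bar>a - b\<bar> \<le> e" if "b \<in> uminus ` B" for b
      using BA that by (force simp: abs_minus_commute)
  qed (use assms in auto)
  then show ?thesis by (simp add: Inf_real_def)
qed

text \<open>
  The quantifier step: every move on either side has an answer, so the sets of values over which the
  supremum or infimum is taken are close to each other.
\<close>

lemma quantified_close:
  assumes X: "tame_space X" and Y: "tame_space Y" and D: "unit_disc_net \<delta> D" and wf: "wf_formula \<phi>"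
    and s: "\<forall>i. s i \<in> unit_ball (C_alg X)" and t: "\<forall>i. t i \<in> unit_ball (C_alg Y)"
    and m: "matched X Y D (Suc k) \<delta> s t"
    and close: "\<And>s t. \<forall>i. s i \<in> unit_ball (C_alg X) \<Longrightarrow> \<forall>i. t i \<in> unit_ball (C_alg Y) \<Longrightarrow>
      matched X Y D k \<delta> s t \<Longrightarrow> \<bar>cl_val (C_alg X) s \<phi> - cl_val (C_alg Y) t \<phi>\<bar> \<le> \<epsilon>"
  shows "\<bar>(SUP a\<in>unit_ball (C_alg X). cl_val (C_alg X) (s(i := a)) \<phi>) -
      (SUP b\<in>unit_ball (C_alg Y). cl_val (C_alg Y) (t(i := b)) \<phi>)\<bar> \<le> \<epsilon>" (is "\<bar>Sup ?A - Sup ?B\<bar> \<le> \<epsilon>")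
    and "\<bar>(INF a\<in>unit_ball (C_alg X). cl_val (C_alg X) (s(i := a)) \<phi>) -
      (INF b\<in>unit_ball (C_alg Y). cl_val (C_alg Y) (t(i := b)) \<phi>)\<bar> \<le> \<epsilon>"
proof -
  have cX: "compact_space X" and cY: "compact_space Y" using X Y by (auto simp: tame_space_def)
  have ne: "?A \<noteq> {}" "?B \<noteq> {}" using zero_mem_unit_ball[OF cX] zero_mem_unit_ball[OF cY] by auto
  have s': "\<forall>j. (s(i := a)) j \<in> unit_ball (C_alg X)" if "a \<in> unit_ball (C_alg X)" for a
    using s that by simp
  have t': "\<forall>j. (t(i := b)) j \<in> unit_ball (C_alg Y)" if "b \<in> unit_ball (C_alg Y)" for b
    using t that by simp
  obtain B where "\<And>s. \<forall>i. s i \<in> unit_ball (C_alg X) \<Longrightarrow> \<bar>cl_val (C_alg X) s \<phi>\<bar> \<le> B"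
    using cl_val_bounded[OF cX wf] by blast
  then have "\<And>x. x \<in> ?A \<Longrightarrow> \<bar>x\<bar> \<le> B" using s' by blast
  then have A: "bdd_above ?A" "bdd_below ?A"
    unfolding bdd_above_def bdd_below_def by (meson abs_le_iff minus_le_iff)+
  obtain C where "\<And>s. \<forall>i. s i \<in> unit_ball (C_alg Y) \<Longrightarrow> \<bar>cl_val (C_alg Y) s \<phi>\<bar> \<le> C"
    using cl_val_bounded[OF cY wf] by blast
  then have "\<And>x. x \<in> ?B \<Longrightarrow> \<bar>x\<bar> \<le> C" using t' by blast
  then have B: "bdd_above ?B" "bdd_below ?B"
    unfolding bdd_above_def bdd_below_def by (meson abs_le_iff minus_le_iff)+
  have AB: "\<exists>y\<in>?B. \<bar>x - y\<bar> \<le> \<epsilon>" if x: "x \<in> ?A" for x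
  proof -
    obtain a where a: "a \<in> unit_ball (C_alg X)" "x = cl_val (C_alg X) (s(i := a)) \<phi>" using x by blast
    obtain b where b: "b \<in> unit_ball (C_alg Y)" "matched X Y D k \<delta> (s(i := a)) (t(i := b))"
      using matched_extend[OF X Y D m a(1)] by blast
    show ?thesis using close[OF s'[OF a(1)] t'[OF b(1)] b(2)] a(2) b(1) by blast
  qed
  have BA: "\<exists>x\<in>?A. \<bar>x - y\<bar> \<le> \<epsilon>" if y: "y \<in> ?B" for y
  proof -
    obtain b where b: "b \<in> unit_ball (C_alg Y)" "y = cl_val (C_alg Y) (t(i := b)) \<phi>" using y by blast
    obtain a where a: "a \<in> unit_ball (C_alg X)" "matched Y X D k \<delta> (t(i := b)) (s(i := a))"
      using matched_extend[OF Y X D matched_sym[OF m] b(1)] by blast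
    show ?thesis using close[OF s'[OF a(1)] t'[OF b(1)] matched_sym[OF a(2)]] b(2) a(1) by blast
  qed
  show "\<bar>Sup ?A - Sup ?B\<bar> \<le> \<epsilon>" by (rule Sup_close[OF ne A(1) B(1) AB BA])
  show "\<bar>Inf ?A - Inf ?B\<bar> \<le> \<epsilon>" by (rule Inf_close[OF ne A(2) B(2) AB BA])
qed

fun quantifier_rank :: "cl_formula \<Rightarrow> nat" where
  "quantifier_rank (Norm P) = 0"
| "quantifier_rank (Conn u \<phi>s) = Max (insert 0 (quantifier_rank ` set \<phi>s))"
| "quantifier_rank (SupBall i \<phi>) = Suc (quantifier_rank \<phi>)"
| "quantifier_rank (InfBall i \<phi>) = Suc (quantifier_rank \<phi>)"

text \<open>
  The tolerance \<open>\<delta>0\<close> has to be found before the net is chosen, as the net and with it the thresholds in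
  the game depend on \<open>\<delta>\<close>. The induction runs over arbitrary positions with enough moves left, because the
  subformulas of a connective have different quantifier ranks.
\<close>

lemma matched_imp_close:
  fixes X :: "'a topology" and Y :: "'b topology"
  assumes X: "tame_space X" and Y: "tame_space Y"
  shows "wf_formula \<phi> \<Longrightarrow> \<epsilon> > 0 \<Longrightarrow>
    \<exists>\<delta>0>0. \<forall>\<delta> D k s t. 0 < \<delta> \<and> \<delta> \<le> \<delta>0 \<and> unit_disc_net \<delta> D \<and> quantifier_rank \<phi> \<le> k \<and>
      (\<forall>i. s i \<in> unit_ball (C_alg X)) \<and> (\<forall>i. t i \<in> unit_ball (C_alg Y)) \<and> matched X Y D k \<delta> s t \<longrightarrow>
      \<bar>cl_val (C_alg X) s \<phi> - cl_val (C_alg Y) t \<phi>\<bar> \<le> \<epsilon>"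
proof (induction \<phi> arbitrary: \<epsilon>)
  have cX: "compact_space X" and cY: "compact_space Y" using X Y by (auto simp: tame_space_def)
  {
    case (Norm P)
    obtain L where L: "L \<ge> 0" "\<And>v w e. (\<forall>i. cmod (v i) \<le> 1) \<and> (\<forall>i. cmod (w i) \<le> 1) \<and>
        (\<forall>i. cmod (v i - w i) \<le> e) \<Longrightarrow> cmod (poly_eval P v - poly_eval P w) \<le> L * e"
      using poly_eval_lipschitz by blast
    obtain B where B: "B \<ge> 0" "\<And>v. \<forall>i. cmod (v i) \<le> 1 \<Longrightarrow> cmod (poly_eval P v) \<le> B"
      using poly_eval_bounded by blast
    define \<delta>0 where "\<delta>0 = \<epsilon> / (2 * (L + 1))"
    have "\<delta>0 > 0" using Norm.prems L by (simp add: \<delta>0_def)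
    moreover have "\<bar>cl_val (C_alg X) s (Norm P) - cl_val (C_alg Y) t (Norm P)\<bar> \<le> \<epsilon>"
      if \<delta>: "0 < \<delta>" "\<delta> \<le> \<delta>0" "unit_disc_net \<delta> D"
        and s: "\<forall>i. s i \<in> unit_ball (C_alg X)" and t: "\<forall>i. t i \<in> unit_ball (C_alg Y)"
        and m: "matched X Y D k \<delta> s t" for \<delta> D k s t
    proof -
      have s1: "cmod (s i x) \<le> 1" if "x \<in> topspace X" for i x
        using s that by (auto simp: unit_ball_C_alg[OF cX])
      have t1: "cmod (t i y) \<le> 1" if "y \<in> topspace Y" for i y
        using t that by (auto simp: unit_ball_C_alg[OF cY])
      have "L * (2 * \<delta>) \<le> (L + 1) * (2 * \<delta>0)"
        using L(1) \<delta> by (intro mult_mono) auto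
      also have "\<dots> = \<epsilon>" using L(1) by (simp add: \<delta>0_def field_simps)
      finally have L\<epsilon>: "L * (2 * \<delta>) \<le> \<epsilon>" .
      have close: "\<bar>cmod (poly_eval P (\<lambda>i. s i x)) - cmod (poly_eval P (\<lambda>i. t i y))\<bar> \<le> \<epsilon>"
        if "x \<in> topspace X" "y \<in> topspace Y" "\<forall>i. cmod (s i x - t i y) \<le> 2 * \<delta>" for x y
        using L(2)[of "\<lambda>i. s i x" "\<lambda>i. t i y" "2 * \<delta>"] that s1 t1 L\<epsilon>
          norm_triangle_ineq3[of "poly_eval P (\<lambda>i. s i x)" "poly_eval P (\<lambda>i. t i y)"] by force
      show ?thesis
        unfolding cl_val_Norm[OF cX s[rule_format]] cl_val_Norm[OF cY t[rule_format]]
      proof (rule Sup_close)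
        show "bdd_above (insert 0 ((\<lambda>x. cmod (poly_eval P (\<lambda>i. s i x))) ` topspace X))"
          using B s1 by (auto intro!: bdd_aboveI2[of _ _ B])
        show "bdd_above (insert 0 ((\<lambda>y. cmod (poly_eval P (\<lambda>i. t i y))) ` topspace Y))"
          using B t1 by (auto intro!: bdd_aboveI2[of _ _ B])
      next
        fix a assume "a \<in> insert 0 ((\<lambda>x. cmod (poly_eval P (\<lambda>i. s i x))) ` topspace X)"
        then consider "a = 0" | x where "x \<in> topspace X" "a = cmod (poly_eval P (\<lambda>i. s i x))" by blast
        then show "\<exists>b\<in>insert 0 ((\<lambda>y. cmod (poly_eval P (\<lambda>i. t i y))) ` topspace Y). \<bar>a - b\<bar> \<le> \<epsilon>"
        proof cases
          case 1
          then show ?thesis using Norm.prems by (intro bexI[of _ 0]) auto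
        next
          case 2
          then obtain y where y: "y \<in> topspace Y" "\<forall>i. cmod (s i x - t i y) \<le> 2 * \<delta>"
            using matched_point[OF m \<delta>(3)] by blast
          then show ?thesis using close[OF 2(1) y] 2(2) by blast
        qed
      next
        fix b assume "b \<in> insert 0 ((\<lambda>y. cmod (poly_eval P (\<lambda>i. t i y))) ` topspace Y)"
        then consider "b = 0" | y where "y \<in> topspace Y" "b = cmod (poly_eval P (\<lambda>i. t i y))" by blast
        then show "\<exists>a\<in>insert 0 ((\<lambda>x. cmod (poly_eval P (\<lambda>i. s i x))) ` topspace X). \<bar>a - b\<bar> \<le> \<epsilon>"
        proof cases
          case 1
          then show ?thesis using Norm.prems by (intro bexI[of _ 0]) auto
        next
          case 2
          then obtain x where x: "x \<in> topspace X" "\<forall>i. cmod (t i y - s i x) \<le> 2 * \<delta>"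
            using matched_point[OF matched_sym[OF m] \<delta>(3)] by blast
          then have "\<forall>i. cmod (s i x - t i y) \<le> 2 * \<delta>" by (simp add: norm_minus_commute)
          then show ?thesis using close[OF x(1) 2(1)] 2(2) x(1) by blast
        qed
      qed auto
    qed
    ultimately show ?case by blast
  next
    case (Conn u \<phi>s)
    let ?n = "length \<phi>s"
    have wf: "\<forall>\<phi>\<in>set \<phi>s. wf_formula \<phi>" and u: "continuous_map (Euclidean_space ?n) euclideanreal u"
      using Conn.prems by auto
    have "\<exists>B. \<forall>s t. (\<forall>i. s i \<in> unit_ball (C_alg X)) \<and> (\<forall>i. t i \<in> unit_ball (C_alg Y)) \<longrightarrow>
        \<bar>cl_val (C_alg X) s \<phi>\<bar> \<le> B \<and> \<bar>cl_val (C_alg Y) t \<phi>\<bar> \<le> B" if "\<phi> \<in> set \<phi>s" for \<phi>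
    proof -
      have \<phi>: "wf_formula \<phi>" using wf that by blast
      obtain B1 where "\<forall>s. (\<forall>i. s i \<in> unit_ball (C_alg X)) \<longrightarrow> \<bar>cl_val (C_alg X) s \<phi>\<bar> \<le> B1"
        using cl_val_bounded[OF cX \<phi>] by blast
      moreover obtain B2 where "\<forall>s. (\<forall>i. s i \<in> unit_ball (C_alg Y)) \<longrightarrow> \<bar>cl_val (C_alg Y) s \<phi>\<bar> \<le> B2"
        using cl_val_bounded[OF cY \<phi>] by blast
      ultimately show ?thesis by (intro exI[of _ "max B1 B2"]) (auto simp: le_max_iff_disj)
    qed
    then have "\<forall>\<phi>\<in>set \<phi>s. \<exists>B. \<forall>s t. (\<forall>i. s i \<in> unit_ball (C_alg X)) \<and> (\<forall>i. t i \<in> unit_ball (C_alg Y)) \<longrightarrow>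
        \<bar>cl_val (C_alg X) s \<phi>\<bar> \<le> B \<and> \<bar>cl_val (C_alg Y) t \<phi>\<bar> \<le> B" by blast
    from bchoice[OF this] obtain B where B: "\<And>\<phi> s t. \<phi> \<in> set \<phi>s \<Longrightarrow> \<forall>i. s i \<in> unit_ball (C_alg X) \<Longrightarrow>
        \<forall>i. t i \<in> unit_ball (C_alg Y) \<Longrightarrow> \<bar>cl_val (C_alg X) s \<phi>\<bar> \<le> B \<phi> \<and> \<bar>cl_val (C_alg Y) t \<phi>\<bar> \<le> B \<phi>"
      by blast
    define M where "M = Max (insert 0 (B ` set \<phi>s))"
    have M: "B \<phi> \<le> M" if "\<phi> \<in> set \<phi>s" for \<phi>
      using that unfolding M_def by (intro Max_ge) auto
    obtain \<eta> where \<eta>: "\<eta> > 0"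
      "\<And>v w. (\<forall>i<?n. \<bar>v i\<bar> \<le> M) \<Longrightarrow> (\<forall>i\<ge>?n. v i = 0) \<Longrightarrow> (\<forall>i<?n. \<bar>w i\<bar> \<le> M) \<Longrightarrow> (\<forall>i\<ge>?n. w i = 0) \<Longrightarrow>
        (\<forall>i<?n. \<bar>v i - w i\<bar> \<le> \<eta>) \<Longrightarrow> \<bar>u v - u w\<bar> \<le> \<epsilon>"
      using connective_uniformly_continuous[OF u Conn.prems(2), of M] by blast
    have "\<forall>\<phi>\<in>set \<phi>s. \<exists>\<delta>0>0. \<forall>\<delta> D k s t. 0 < \<delta> \<and> \<delta> \<le> \<delta>0 \<and> unit_disc_net \<delta> D \<and> quantifier_rank \<phi> \<le> k \<and>
      (\<forall>i. s i \<in> unit_ball (C_alg X)) \<and> (\<forall>i. t i \<in> unit_ball (C_alg Y)) \<and> matched X Y D k \<delta> s t \<longrightarrow>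
      \<bar>cl_val (C_alg X) s \<phi> - cl_val (C_alg Y) t \<phi>\<bar> \<le> \<eta>"
      using Conn.IH wf \<eta>(1) by blast
    from bchoice[OF this] obtain d where d: "\<And>\<phi>. \<phi> \<in> set \<phi>s \<Longrightarrow> d \<phi> > 0"
      "\<And>\<phi> \<delta> D k s t. \<phi> \<in> set \<phi>s \<Longrightarrow> 0 < \<delta> \<and> \<delta> \<le> d \<phi> \<and> unit_disc_net \<delta> D \<and> quantifier_rank \<phi> \<le> k \<and>
        (\<forall>i. s i \<in> unit_ball (C_alg X)) \<and> (\<forall>i. t i \<in> unit_ball (C_alg Y)) \<and> matched X Y D k \<delta> s t \<Longrightarrow>
        \<bar>cl_val (C_alg X) s \<phi> - cl_val (C_alg Y) t \<phi>\<bar> \<le> \<eta>"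
      by blast
    define \<delta>0 where "\<delta>0 = Min (insert 1 (d ` set \<phi>s))"
    have "\<delta>0 > 0" unfolding \<delta>0_def using d(1) by (subst Min_gr_iff) auto
    have \<delta>0: "\<delta>0 \<le> d \<phi>" if "\<phi> \<in> set \<phi>s" for \<phi>
      using that unfolding \<delta>0_def by (intro Min_le) auto
    have "\<bar>cl_val (C_alg X) s (Conn u \<phi>s) - cl_val (C_alg Y) t (Conn u \<phi>s)\<bar> \<le> \<epsilon>"
      if h: "0 < \<delta> \<and> \<delta> \<le> \<delta>0 \<and> unit_disc_net \<delta> D \<and> quantifier_rank (Conn u \<phi>s) \<le> k \<and>
        (\<forall>i. s i \<in> unit_ball (C_alg X)) \<and> (\<forall>i. t i \<in> unit_ball (C_alg Y)) \<and> matched X Y D k \<delta> s t"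
      for \<delta> D k s t
    proof -
      have s: "\<forall>i. s i \<in> unit_ball (C_alg X)" and t: "\<forall>i. t i \<in> unit_ball (C_alg Y)" using h by auto
      have "\<bar>cl_val (C_alg X) s \<phi> - cl_val (C_alg Y) t \<phi>\<bar> \<le> \<eta>" if \<phi>: "\<phi> \<in> set \<phi>s" for \<phi>
      proof (rule d(2)[OF \<phi>])
        show "0 < \<delta> \<and> \<delta> \<le> d \<phi> \<and> unit_disc_net \<delta> D \<and> quantifier_rank \<phi> \<le> k \<and>
          (\<forall>i. s i \<in> unit_ball (C_alg X)) \<and> (\<forall>i. t i \<in> unit_ball (C_alg Y)) \<and> matched X Y D k \<delta> s t"
          using h \<delta>0[OF \<phi>] \<phi> by simp
      qed
      moreover have "\<bar>cl_val (C_alg X) s \<phi>\<bar> \<le> M \<and> \<bar>cl_val (C_alg Y) t \<phi>\<bar> \<le> M" if "\<phi> \<in> set \<phi>s" for \<phi>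
        using B[OF that s t] M[OF that] by linarith
      ultimately show ?thesis unfolding cl_val_Conn by (intro \<eta>(2)) auto
    qed
    then show ?case using \<open>\<delta>0 > 0\<close> by blast
  next
    case (SupBall i \<phi>)
    then have wf: "wf_formula \<phi>" by simp
    obtain \<delta>0 where "\<delta>0 > 0" and \<delta>0: "\<And>\<delta> D k s t. 0 < \<delta> \<Longrightarrow> \<delta> \<le> \<delta>0 \<Longrightarrow> unit_disc_net \<delta> D \<Longrightarrow>
      quantifier_rank \<phi> \<le> k \<Longrightarrow> (\<forall>i. s i \<in> unit_ball (C_alg X)) \<Longrightarrow> (\<forall>i. t i \<in> unit_ball (C_alg Y)) \<Longrightarrow>
      matched X Y D k \<delta> s t \<Longrightarrow> \<bar>cl_val (C_alg X) s \<phi> - cl_val (C_alg Y) t \<phi>\<bar> \<le> \<epsilon>"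
      using SupBall.IH[OF wf SupBall.prems(2)] by blast
    have "\<bar>cl_val (C_alg X) s (SupBall i \<phi>) - cl_val (C_alg Y) t (SupBall i \<phi>)\<bar> \<le> \<epsilon>"
      if h: "0 < \<delta>" "\<delta> \<le> \<delta>0" "unit_disc_net \<delta> D" "quantifier_rank (SupBall i \<phi>) \<le> k"
        "\<forall>i. s i \<in> unit_ball (C_alg X)" "\<forall>i. t i \<in> unit_ball (C_alg Y)" "matched X Y D k \<delta> s t"
      for \<delta> D k s t
    proof -
      obtain k' where k': "k = Suc k'" "quantifier_rank \<phi> \<le> k'" using h(4) by (cases k) auto
      show ?thesis
        unfolding cl_val.simps
        by (rule quantified_close(1)[OF X Y h(3) wf h(5,6) h(7)[unfolded k'(1)] \<delta>0[OF h(1-3) k'(2)]])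
    qed
    then show ?case using \<open>\<delta>0 > 0\<close> by blast
  next
    case (InfBall i \<phi>)
    then have wf: "wf_formula \<phi>" by simp
    obtain \<delta>0 where "\<delta>0 > 0" and \<delta>0: "\<And>\<delta> D k s t. 0 < \<delta> \<Longrightarrow> \<delta> \<le> \<delta>0 \<Longrightarrow> unit_disc_net \<delta> D \<Longrightarrow>
      quantifier_rank \<phi> \<le> k \<Longrightarrow> (\<forall>i. s i \<in> unit_ball (C_alg X)) \<Longrightarrow> (\<forall>i. t i \<in> unit_ball (C_alg Y)) \<Longrightarrow>
      matched X Y D k \<delta> s t \<Longrightarrow> \<bar>cl_val (C_alg X) s \<phi> - cl_val (C_alg Y) t \<phi>\<bar> \<le> \<epsilon>"
      using InfBall.IH[OF wf InfBall.prems(2)] by blast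
    have "\<bar>cl_val (C_alg X) s (InfBall i \<phi>) - cl_val (C_alg Y) t (InfBall i \<phi>)\<bar> \<le> \<epsilon>"
      if h: "0 < \<delta>" "\<delta> \<le> \<delta>0" "unit_disc_net \<delta> D" "quantifier_rank (InfBall i \<phi>) \<le> k"
        "\<forall>i. s i \<in> unit_ball (C_alg X)" "\<forall>i. t i \<in> unit_ball (C_alg Y)" "matched X Y D k \<delta> s t"
      for \<delta> D k s t
    proof -
      obtain k' where k': "k = Suc k'" "quantifier_rank \<phi> \<le> k'" using h(4) by (cases k) auto
      show ?thesis
        unfolding cl_val.simps
        by (rule quantified_close(2)[OF X Y h(3) wf h(5,6) h(7)[unfolded k'(1)] \<delta>0[OF h(1-3) k'(2)]])
    qed
    then show ?case using \<open>\<delta>0 > 0\<close> by blast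
  }
qed

text \<open>
  At the start of the game there is a single piece, the whole space. Since the tolerance is arbitrary, the
  values of a sentence in the two algebras are equal, not only zero at the same time.
\<close>

theorem tame_spaces_elem_equiv:
  assumes X: "tame_space X" and Y: "tame_space Y"
    and sim: "\<And>T. similar X Y T (topspace X) (topspace Y)"
  shows "C_alg X \<equiv>\<^sub>e C_alg Y"
proof -
  let ?s = "\<lambda>_. \<zero>\<^bsub>C_alg X\<^esub>" and ?t = "\<lambda>_. \<zero>\<^bsub>C_alg Y\<^esub>"
  have cX: "compact_space X" and cY: "compact_space Y" using X Y by (auto simp: tame_space_def)
  have "cl_val (C_alg X) ?s \<phi> = cl_val (C_alg Y) ?t \<phi>" if "cl_sentence \<phi>" for \<phi>
  proof -
    have "\<bar>cl_val (C_alg X) ?s \<phi> - cl_val (C_alg Y) ?t \<phi>\<bar> \<le> \<epsilon>" if \<epsilon>: "\<epsilon> > 0" for \<epsilon>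
    proof -
      have "wf_formula \<phi>" using \<open>cl_sentence \<phi>\<close> by (simp add: cl_sentence_def)
      from matched_imp_close[OF X Y this \<epsilon>]
      obtain \<delta> where "\<delta> > 0" and \<delta>: "\<And>D k s t. unit_disc_net \<delta> D \<Longrightarrow> quantifier_rank \<phi> \<le> k \<Longrightarrow>
        (\<forall>i. s i \<in> unit_ball (C_alg X)) \<Longrightarrow> (\<forall>i. t i \<in> unit_ball (C_alg Y)) \<Longrightarrow>
        matched X Y D k \<delta> s t \<Longrightarrow> \<bar>cl_val (C_alg X) s \<phi> - cl_val (C_alg Y) t \<phi>\<bar> \<le> \<epsilon>"
        by blast
      obtain D where D: "unit_disc_net \<delta> D" using unit_disc_net_exists[OF \<open>\<delta> > 0\<close>] by blast
      have "matched X Y D (quantifier_rank \<phi>) \<delta> ?s ?t"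
        unfolding matched_def
      proof (intro exI conjI allI ballI)
        show "similar X Y (card D ^ quantifier_rank \<phi>) (fibre X (\<lambda>_. []) l) (fibre Y (\<lambda>_. []) l)"
          for l :: "complex list"
          using sim similar_empty by (cases l) (auto simp: fibre_def)
        show "dist (\<zero>\<^bsub>C_alg X\<^esub> x) ((\<lambda>_ _. 0) [] i) \<le> \<delta>" if "x \<in> topspace X" for i :: nat and x
          using that \<open>\<delta> > 0\<close> by (simp add: C_alg_def)
        show "dist (\<zero>\<^bsub>C_alg Y\<^esub> y) ((\<lambda>_ _. 0) [] i) \<le> \<delta>" if "y \<in> topspace Y" for i :: nat and y
          using that \<open>\<delta> > 0\<close> by (simp add: C_alg_def)
      qed (rule locally_constant_const)+
      then show ?thesis
        by (intro \<delta>[OF D order_refl]) (simp_all add: zero_mem_unit_ball cX cY)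
    qed
    then show ?thesis
      using zero_less_abs_iff[of "cl_val (C_alg X) ?s \<phi> - cl_val (C_alg Y) ?t \<phi>"]
      by (metis diff_gt_0_iff_gt dense not_less right_minus_eq)
  qed
  then show ?thesis by (simp add: elem_equiv_def)
qed


section \<open>Stone--Cech compactifications\<close>

lemma compact_sc_cube: "compact_space (sc_cube Z)"
  by (simp add: sc_cube_def compact_space_product_topology compact_space_subtopology)

lemma continuous_map_sc_coordinate:
  assumes "f \<in> unit_functions Z"
  shows "continuous_map (stone_cech Z) euclideanreal (\<lambda>w. w f)"
proof -
  have "continuous_map (sc_cube Z) (top_of_set {0..1}) (\<lambda>w. w f)"
    unfolding sc_cube_def using assms by (rule continuous_map_product_projection)
  then have "continuous_map (sc_cube Z) euclideanreal (\<lambda>w. w f)"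
    by (simp add: continuous_map_in_subtopology)
  then show ?thesis unfolding stone_cech_def by (rule continuous_map_from_subtopology)
qed

lemma sc_embed_in_cube:
  assumes "z \<in> topspace Z"
  shows "sc_embed Z z \<in> topspace (sc_cube Z)"
  using assms by (auto simp: sc_cube_def sc_embed_def unit_functions_def continuous_map_def)

lemma topspace_stone_cech:
  "topspace (stone_cech Z) = sc_cube Z closure_of (sc_embed Z ` topspace Z)"
  by (simp add: stone_cech_def closure_of_subset_topspace inf.absorb2)

lemma compact_stone_cech: "compact_space (stone_cech Z)"
  unfolding stone_cech_def
  by (intro compact_space_subtopology closedin_compact_space compact_sc_cube) auto

lemma sc_embed_in_stone_cech: "z \<in> topspace Z \<Longrightarrow> sc_embed Z z \<in> topspace (stone_cech Z)"
proof -
  assume z: "z \<in> topspace Z"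
  have "sc_embed Z ` topspace Z \<subseteq> topspace (sc_cube Z)" by (auto simp: sc_embed_in_cube)
  then show ?thesis unfolding topspace_stone_cech using closure_of_subset z by blast
qed

text \<open>
  Density of \<open>Z\<close> in \<open>\<beta>Z\<close>, in the form in which it is used: a closed condition can be checked on \<open>Z\<close>.
\<close>

lemma sc_dense:
  assumes "closedin (stone_cech Z) C" and "\<And>z. z \<in> topspace Z \<Longrightarrow> sc_embed Z z \<in> C"
  shows "topspace (stone_cech Z) \<subseteq> C"
proof -
  have "closedin (sc_cube Z) C"
    using assms(1) unfolding stone_cech_def by (rule closedin_trans_full) auto
  then show ?thesis
    unfolding topspace_stone_cech by (rule closure_of_minimal[rotated]) (use assms(2) in auto)
qed

lemma continuous_map_sc_embed: "continuous_map Z (stone_cech Z) (sc_embed Z)"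
proof -
  have "continuous_map Z (sc_cube Z) (sc_embed Z)"
    unfolding sc_cube_def
  proof (subst continuous_map_componentwise, intro conjI ballI)
    show "sc_embed Z ` topspace Z \<subseteq> extensional (unit_functions Z)" by (auto simp: sc_embed_def)
    show "continuous_map Z (top_of_set {0..1}) (\<lambda>z. sc_embed Z z f)" if "f \<in> unit_functions Z" for f
      using that by (simp add: sc_embed_def unit_functions_def)
  qed
  then show ?thesis
    unfolding stone_cech_def
    by (rule continuous_map_into_subtopology) (use sc_embed_in_stone_cech[of _ Z] in \<open>auto simp: topspace_stone_cech\<close>)
qed

text \<open>
  The characteristic function of \<open>E\<close> is one of the coordinates of the cube; by density it takes only
  the values 0 and 1 on \<open>\<beta>Z\<close>.
\<close>

lemma sc_clopen_extension:
  assumes E: "clopenin Z E"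
  shows "\<exists>K. clopenin (stone_cech Z) K \<and> (\<forall>z\<in>topspace Z. sc_embed Z z \<in> K \<longleftrightarrow> z \<in> E)"
proof -
  define f where "f = restrict (\<lambda>z. if z \<in> E then 1 else 0 :: real) (topspace Z)"
  have "locally_constant Z (\<lambda>z. if z \<in> E then 1 else 0 :: real)"
    by (intro locally_constant_if E locally_constant_const)
  then have "continuous_map Z (top_of_set {0..1}) (\<lambda>z. if z \<in> E then 1 else 0 :: real)"
    by (rule locally_constant_imp_continuous_map) auto
  then have "continuous_map Z (top_of_set {0..1}) f"
    by (rule continuous_map_eq) (simp add: f_def)
  then have f: "f \<in> unit_functions Z" by (simp add: unit_functions_def f_def)
  have em: "sc_embed Z z f = (if z \<in> E then 1 else 0)" if "z \<in> topspace Z" for z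
    using that f by (simp add: sc_embed_def) (simp add: f_def)
  define K where "K = (\<lambda>c. {w \<in> topspace (stone_cech Z). w f \<in> {c :: real}})"
  have cl: "closedin (stone_cech Z) (K c)" for c
    unfolding K_def by (rule closedin_continuous_map_preimage[OF continuous_map_sc_coordinate[OF f]]) auto
  have "topspace (stone_cech Z) \<subseteq> K 0 \<union> K 1"
    by (rule sc_dense[OF closedin_Un[OF cl cl]]) (auto simp: em K_def sc_embed_in_stone_cech)
  then have "topspace (stone_cech Z) - K 1 = K 0" by (auto simp: K_def)
  then have "clopenin (stone_cech Z) (K 1)"
    using cl[of 0] cl[of 1] closedin_subset[OF cl[of 1]]
    by (metis clopenin_def openin_closedin)
  moreover have "sc_embed Z z \<in> K 1 \<longleftrightarrow> z \<in> E" if "z \<in> topspace Z" for z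
    using that by (simp add: K_def em sc_embed_in_stone_cech)
  ultimately show ?thesis by blast
qed

lemma sc_clopen_subset:
  assumes K: "clopenin (stone_cech Z) K" and C: "closedin (stone_cech Z) C"
    and KC: "\<And>z. z \<in> topspace Z \<Longrightarrow> sc_embed Z z \<in> K \<Longrightarrow> sc_embed Z z \<in> C"
  shows "K \<subseteq> C"
proof -
  have "topspace (stone_cech Z) \<subseteq> (topspace (stone_cech Z) - K) \<union> C"
    by (rule sc_dense) (use clopenin_compl[OF K] C KC sc_embed_in_stone_cech in \<open>auto simp: clopenin_def\<close>)
  then show ?thesis using clopenin_subset[OF K] by blast
qed

text \<open>
  If two points of \<open>\<beta>Z\<close> differ in the coordinate \<open>f\<close>, a number \<open>c\<close> strictly between their values
  and outside the countable range of \<open>f\<close> makes \<open>{f < c} = {f \<le> c}\<close> clopen in \<open>Z\<close>. Its extension to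
  \<open>\<beta>Z\<close> separates the points.
\<close>

lemma totally_separated_stone_cech:
  assumes Z: "countable (topspace Z)"
  shows "totally_separated_space (stone_cech Z)"
proof -
  have *: "\<exists>K. clopenin (stone_cech Z) K \<and> u \<in> K \<and> v \<notin> K"
    if u: "u \<in> topspace (stone_cech Z)" and v: "v \<in> topspace (stone_cech Z)"
      and f: "f \<in> unit_functions Z" and uv: "u f < v f" for u v f
  proof -
    have "countable (f ` topspace Z)" "uncountable {u f<..<v f}"
      using Z uv by (simp_all add: uncountable_open_interval)
    then have "\<not> {u f<..<v f} \<subseteq> f ` topspace Z" using countable_subset by blast
    then obtain c where "c \<in> {u f<..<v f}" and c3: "c \<notin> f ` topspace Z" by blast
    then have c: "u f < c" "c < v f" by auto
    have fc: "continuous_map Z euclideanreal f"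
      using f by (simp add: unit_functions_def continuous_map_in_subtopology)
    define E where "E = {z \<in> topspace Z. f z < c}"
    have "openin Z E" "closedin Z {z \<in> topspace Z. f z \<in> {..c}}"
      unfolding E_def using openin_continuous_map_preimage[OF fc, of "{..<c}"]
        closedin_continuous_map_preimage[OF fc, of "{..c}"] by auto
    moreover have "{z \<in> topspace Z. f z \<in> {..c}} = E" using c3 by (force simp: E_def)
    ultimately have "clopenin Z E" by (simp add: clopenin_def)
    then obtain K where K: "clopenin (stone_cech Z) K" "\<And>z. z \<in> topspace Z \<Longrightarrow> sc_embed Z z \<in> K \<longleftrightarrow> z \<in> E"
      using sc_clopen_extension by blast
    have em: "sc_embed Z z f = f z" for z using f by (simp add: sc_embed_def)
    note cm = continuous_map_sc_coordinate[OF f]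
    have "K \<subseteq> {w \<in> topspace (stone_cech Z). w f \<in> {..c}}"
      by (rule sc_clopen_subset[OF K(1) closedin_continuous_map_preimage[OF cm]])
        (auto simp: K(2) em E_def sc_embed_in_stone_cech)
    then have "v \<notin> K" using c(2) by auto
    have "topspace (stone_cech Z) - K \<subseteq> {w \<in> topspace (stone_cech Z). w f \<in> {c..}}"
      by (rule sc_clopen_subset[OF clopenin_compl[OF K(1)] closedin_continuous_map_preimage[OF cm]])
        (auto simp: K(2) em E_def sc_embed_in_stone_cech)
    then have "u \<in> K" using c(1) u by auto
    then show ?thesis using K(1) \<open>v \<notin> K\<close> by blast
  qed
  show ?thesis
    unfolding totally_separated_space_def
  proof (intro ballI impI)
    fix u v assume u: "u \<in> topspace (stone_cech Z)" and v: "v \<in> topspace (stone_cech Z)" and "u \<noteq> v"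
    have "u \<in> topspace (sc_cube Z)" "v \<in> topspace (sc_cube Z)"
      using u v by (auto simp: stone_cech_def)
    then have "u \<in> extensional (unit_functions Z)" "v \<in> extensional (unit_functions Z)"
      by (auto simp: sc_cube_def PiE_def)
    then obtain f where f: "f \<in> unit_functions Z" "u f \<noteq> v f"
      using \<open>u \<noteq> v\<close> extensionalityI[of u _ v] by blast
    show "\<exists>K. clopenin (stone_cech Z) K \<and> u \<in> K \<and> v \<notin> K"
    proof (cases "u f < v f")
      case True
      then show ?thesis using *[OF u v f(1)] by blast
    next
      case False
      then obtain K where K: "clopenin (stone_cech Z) K" "v \<in> K" "u \<notin> K"
        using *[OF v u f(1)] f(2) by force
      then show ?thesis using clopenin_compl[OF K(1)] u by blast
    qed
  qed
qed

lemma sc_singleton_clopen: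
  assumes z: "clopenin Z {z}" and Z: "countable (topspace Z)"
  shows "clopenin (stone_cech Z) {sc_embed Z z}"
    and "z' \<in> topspace Z \<Longrightarrow> sc_embed Z z' = sc_embed Z z \<Longrightarrow> z' = z"
proof -
  have zZ: "z \<in> topspace Z" using clopenin_subset[OF z] by simp
  obtain K where K: "clopenin (stone_cech Z) K" "\<And>y. y \<in> topspace Z \<Longrightarrow> sc_embed Z y \<in> K \<longleftrightarrow> y \<in> {z}"
    using sc_clopen_extension[OF z] by blast
  show "z' \<in> topspace Z \<Longrightarrow> sc_embed Z z' = sc_embed Z z \<Longrightarrow> z' = z"
    using K(2)[of z'] K(2)[OF zZ] by simp
  have "K \<subseteq> {sc_embed Z z}"
  proof
    fix w assume w: "w \<in> K"
    show "w \<in> {sc_embed Z z}"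
    proof (rule ccontr)
      assume "w \<notin> {sc_embed Z z}"
      then have "sc_embed Z z \<noteq> w" by simp
      moreover have "w \<in> topspace (stone_cech Z)" using w clopenin_subset[OF K(1)] by blast
      ultimately obtain L where L: "clopenin (stone_cech Z) L" "sc_embed Z z \<in> L" "w \<notin> L"
        using totally_separatedD[OF totally_separated_stone_cech[OF Z] sc_embed_in_stone_cech[OF zZ]] by blast
      have "K \<subseteq> L"
        by (rule sc_clopen_subset[OF K(1)]) (use L K(2) in \<open>auto simp: clopenin_def\<close>)
      then show False using w L(3) by blast
    qed
  qed
  then have "K = {sc_embed Z z}" using K(2)[OF zZ] by auto
  then show "clopenin (stone_cech Z) {sc_embed Z z}" using K(1) by simp
qed

text \<open>
  What the countable limit ordinals have in common: \<open>\<rho>\<close> is a proper map to \<open>\<omega>\<close> with infinite range. A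
  subset of \<open>Z\<close> escapes every compact set of the exhaustion \<open>{\<rho> \<le> m}\<close> iff \<open>\<rho>\<close> is unbounded on it.
\<close>

locale exhausted_space =
  fixes Z :: "'a topology" and \<rho> :: "'a \<Rightarrow> nat"
  assumes cnt: "countable (topspace Z)" and \<rho>: "locally_constant Z \<rho>"
    and unbounded: "infinite (\<rho> ` topspace Z)"
    and cpt: "\<And>m. compactin Z {z \<in> topspace Z. \<rho> z \<le> m}"
begin

lemma topspace_remainder: "topspace (sc_remainder Z) = topspace (stone_cech Z) - sc_embed Z ` topspace Z"
  by (auto simp: sc_remainder_def)

text \<open>
  If \<open>\<rho>\<close> is bounded on the trace of \<open>K\<close>, the trace lies in a compact set, the image of that set is
  closed in \<open>\<beta>Z\<close>, and so \<open>K\<close>, the closure of its trace, lies in the image of \<open>Z\<close>. Conversely, if the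
  compact set \<open>K\<close> lies in the image, finitely many of the extensions \<open>U m\<close> of \<open>{\<rho> \<le> m}\<close> cover it,
  which bounds \<open>\<rho>\<close> on the trace.
\<close>

lemma clopen_meets_remainder_iff:
  assumes K: "clopenin (stone_cech Z) K"
  shows "K \<inter> topspace (sc_remainder Z) \<noteq> {} \<longleftrightarrow> infinite (\<rho> ` {z \<in> topspace Z. sc_embed Z z \<in> K})"
    (is "_ \<longleftrightarrow> infinite (\<rho> ` ?E)")
proof
  assume meet: "K \<inter> topspace (sc_remainder Z) \<noteq> {}"
  show "infinite (\<rho> ` ?E)"
  proof
    assume "finite (\<rho> ` ?E)"
    then obtain m where m: "\<And>z. z \<in> ?E \<Longrightarrow> \<rho> z \<le> m"
      by (metis finite_nat_set_iff_bounded_le image_eqI)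
    have "K \<subseteq> sc_embed Z ` topspace Z"
    proof
      fix w assume w: "w \<in> K"
      show "w \<in> sc_embed Z ` topspace Z"
      proof (rule ccontr)
        assume nw: "w \<notin> sc_embed Z ` topspace Z"
        let ?C = "sc_embed Z ` {z \<in> topspace Z. \<rho> z \<le> m}"
        have cC: "compactin (stone_cech Z) ?C"
          by (rule image_compactin[OF cpt continuous_map_sc_embed])
        have wS: "w \<in> topspace (stone_cech Z)" using w clopenin_subset[OF K] by blast
        let ?\<U> = "{L. clopenin (stone_cech Z) L \<and> w \<notin> L}"
        have "?C \<subseteq> \<Union>?\<U>"
        proof
          fix v assume v: "v \<in> ?C"
          then have "v \<in> topspace (stone_cech Z)" "v \<noteq> w"
            using nw sc_embed_in_stone_cech by auto
          then show "v \<in> \<Union>?\<U>"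
            using totally_separatedD[OF totally_separated_stone_cech[OF cnt] _ wS] by blast
        qed
        moreover have "\<forall>L\<in>?\<U>. openin (stone_cech Z) L" by (auto simp: clopenin_def)
        ultimately obtain \<F> where \<F>: "finite \<F>" "\<F> \<subseteq> ?\<U>" "?C \<subseteq> \<Union>\<F>"
          using cC unfolding compactin_def by meson
        have "closedin (stone_cech Z) (\<Union>\<F>)"
          using \<F>(1,2) by (intro closedin_Union) (auto simp: clopenin_def)
        then have "K \<subseteq> \<Union>\<F>"
          by (rule sc_clopen_subset[OF K]) (use m \<F>(3) in blast)
        then show False using w \<F>(2) by blast
      qed
    qed
    then show False using meet by (auto simp: topspace_remainder)
  qed
next
  assume inf: "infinite (\<rho> ` ?E)"
  show "K \<inter> topspace (sc_remainder Z) \<noteq> {}"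
  proof
    assume "K \<inter> topspace (sc_remainder Z) = {}"
    then have KE: "K \<subseteq> sc_embed Z ` topspace Z"
      using clopenin_subset[OF K] by (auto simp: topspace_remainder)
    have "\<forall>m. \<exists>U. clopenin (stone_cech Z) U \<and> (\<forall>z\<in>topspace Z. sc_embed Z z \<in> U \<longleftrightarrow> z \<in> {z \<in> topspace Z. \<rho> z \<in> {..m}})"
      by (intro allI sc_clopen_extension clopenin_locally_constant_preimage[OF \<rho>])
    from choice[OF this] obtain U where U: "\<And>m. clopenin (stone_cech Z) (U m)"
      "\<And>m z. z \<in> topspace Z \<Longrightarrow> sc_embed Z z \<in> U m \<longleftrightarrow> \<rho> z \<le> m" by auto
    have "compactin (stone_cech Z) K"
      using K compact_stone_cech closedin_compact_space by (auto simp: clopenin_def)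
    moreover have "K \<subseteq> \<Union>(range U)"
    proof
      fix w assume "w \<in> K"
      then obtain z where "z \<in> topspace Z" "w = sc_embed Z z" using KE by blast
      then have "w \<in> U (\<rho> z)" using U(2) by simp
      then show "w \<in> \<Union>(range U)" by blast
    qed
    moreover have "\<forall>V\<in>range U. openin (stone_cech Z) V" using U(1) by (auto simp: clopenin_def)
    ultimately obtain \<F> where \<F>: "finite \<F>" "\<F> \<subseteq> range U" "K \<subseteq> \<Union>\<F>"
      unfolding compactin_def by meson
    then obtain M where M: "finite M" "\<F> = U ` M" by (meson finite_subset_image)
    have "\<rho> ` ?E \<subseteq> (\<Union>m\<in>M. {..m})"
    proof
      fix n assume "n \<in> \<rho> ` ?E"
      then obtain z where z: "z \<in> topspace Z" "sc_embed Z z \<in> K" "n = \<rho> z" by blast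
      then obtain m where "m \<in> M" "sc_embed Z z \<in> U m" using \<F>(3) M(2) by blast
      then show "n \<in> (\<Union>m\<in>M. {..m})" using z U(2) by auto
    qed
    then have "finite (\<rho> ` ?E)" by (rule finite_subset) (use M in auto)
    then show False using inf by blast
  qed
qed

text \<open>
  The exhaustion makes \<open>Z\<close> locally compact, which is why it is open in \<open>\<beta>Z\<close> and its remainder compact.
\<close>

lemma openin_image: "openin (stone_cech Z) (sc_embed Z ` topspace Z)"
proof (subst openin_subopen, intro ballI)
  fix w assume "w \<in> sc_embed Z ` topspace Z"
  then obtain z where z: "z \<in> topspace Z" "w = sc_embed Z z" by blast
  obtain K where K: "clopenin (stone_cech Z) K"
    "\<And>y. y \<in> topspace Z \<Longrightarrow> sc_embed Z y \<in> K \<longleftrightarrow> y \<in> {y \<in> topspace Z. \<rho> y \<in> {..\<rho> z}}"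
    using sc_clopen_extension[OF clopenin_locally_constant_preimage[OF \<rho>, of "{..\<rho> z}"]] by blast
  have "\<rho> ` {y \<in> topspace Z. sc_embed Z y \<in> K} \<subseteq> {..\<rho> z}" using K(2) by auto
  then have "finite (\<rho> ` {y \<in> topspace Z. sc_embed Z y \<in> K})" by (rule finite_subset) simp
  then have "K \<inter> topspace (sc_remainder Z) = {}"
    using clopen_meets_remainder_iff[OF K(1)] by blast
  then have "K \<subseteq> sc_embed Z ` topspace Z"
    using clopenin_subset[OF K(1)] by (auto simp: topspace_remainder)
  moreover have "w \<in> K" using K(2)[OF z(1)] z by simp
  ultimately show "\<exists>T. openin (stone_cech Z) T \<and> w \<in> T \<and> T \<subseteq> sc_embed Z ` topspace Z"
    using K(1) by (auto simp: clopenin_def)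
qed

lemma compact_remainder: "compact_space (sc_remainder Z)"
  unfolding sc_remainder_def
  by (intro compact_space_subtopology closedin_compact_space compact_stone_cech
      closedin_diff closedin_topspace openin_image)

lemma totally_separated_remainder: "totally_separated_space (sc_remainder Z)"
  unfolding totally_separated_space_def
proof (intro ballI impI)
  fix u v assume u: "u \<in> topspace (sc_remainder Z)" and v: "v \<in> topspace (sc_remainder Z)" and "u \<noteq> v"
  then obtain K where K: "clopenin (stone_cech Z) K" "u \<in> K" "v \<notin> K"
    using totally_separatedD[OF totally_separated_stone_cech[OF cnt], of u v]
    by (auto simp: topspace_remainder)
  have "clopenin (sc_remainder Z) (K \<inter> topspace (sc_remainder Z))"
    using K(1) unfolding topspace_remainder sc_remainder_def clopenin_def
    by (auto simp: openin_subtopology closedin_subtopology)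
  then show "\<exists>L. clopenin (sc_remainder Z) L \<and> u \<in> L \<and> v \<notin> L"
    using K u by blast
qed

lemma remainder_nonempty: "topspace (sc_remainder Z) \<noteq> {}"
proof -
  have "{z \<in> topspace Z. sc_embed Z z \<in> topspace (stone_cech Z)} = topspace Z"
    by (auto simp: sc_embed_in_stone_cech)
  then show ?thesis
    using clopen_meets_remainder_iff[of "topspace (stone_cech Z)"] unbounded by auto
qed

text \<open>
  On the trace of a clopen neighbourhood of a point of the remainder, \<open>\<rho>\<close> takes infinitely many values.
  Splitting these values into two infinite sets cuts the neighbourhood into two clopen parts that both
  reach the remainder.
\<close>

lemma remainder_no_isolated_points: "isolated_points (sc_remainder Z) = {}"
proof (rule ccontr)
  assume "isolated_points (sc_remainder Z) \<noteq> {}"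
  then obtain u where u: "u \<in> topspace (sc_remainder Z)" "openin (sc_remainder Z) {u}"
    by (auto simp: isolated_points_def)
  then obtain U where U: "openin (stone_cech Z) U" "{u} = U \<inter> topspace (sc_remainder Z)"
    by (auto simp: sc_remainder_def openin_subtopology)
  then obtain K where K: "clopenin (stone_cech Z) K" "u \<in> K" "K \<subseteq> U"
    using compact_totally_separated_imp_clopen_neighbourhood[OF compact_stone_cech totally_separated_stone_cech[OF cnt] U(1)]
    by blast
  have only: "v = u" if "v \<in> K" "v \<in> topspace (sc_remainder Z)" for v
    using that K(3) U(2) by blast
  define E where "E = {z \<in> topspace Z. sc_embed Z z \<in> K}"
  have "infinite (\<rho> ` E)"
    using clopen_meets_remainder_iff[OF K(1)] K(2) u(1) unfolding E_def by blast
  then obtain f :: "nat \<Rightarrow> nat" where f: "strict_mono f" "\<And>n. f n \<in> \<rho> ` E"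
    using infinite_enumerate by metis
  (* Every second value of rho on the trace. *)
  define S where "S = range (\<lambda>n. f (2 * n))"
  obtain L where L: "clopenin (stone_cech Z) L"
    "\<And>z. z \<in> topspace Z \<Longrightarrow> sc_embed Z z \<in> L \<longleftrightarrow> z \<in> {z \<in> topspace Z. \<rho> z \<in> S}"
    using sc_clopen_extension[OF clopenin_locally_constant_preimage[OF \<rho>, of S]] by blast
  have inj: "inj f" using f(1) by (simp add: strict_mono_imp_inj_on)
  have "range (\<lambda>n. f (2 * n)) \<subseteq> \<rho> ` {z \<in> topspace Z. sc_embed Z z \<in> K \<inter> L}"
  proof clarify
    fix n
    obtain z where z: "z \<in> E" "f (2 * n) = \<rho> z" using f(2) by blast
    moreover have "f (2 * n) \<in> S" unfolding S_def by blast
    ultimately show "f (2 * n) \<in> \<rho> ` {z \<in> topspace Z. sc_embed Z z \<in> K \<inter> L}"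
      using L(2)[of z] by (auto simp: E_def)
  qed
  moreover have "infinite (range (\<lambda>n. f (2 * n)))"
    by (intro range_inj_infinite injI) (simp add: inj_eq[OF inj])
  ultimately have "infinite (\<rho> ` {z \<in> topspace Z. sc_embed Z z \<in> K \<inter> L})" by (meson finite_subset)
  then have "(K \<inter> L) \<inter> topspace (sc_remainder Z) \<noteq> {}"
    using clopen_meets_remainder_iff[OF clopenin_Int[OF K(1) L(1)]] by blast
  then have "u \<in> L" using only by blast
  have "range (\<lambda>n. f (2 * n + 1)) \<subseteq> \<rho> ` {z \<in> topspace Z. sc_embed Z z \<in> K - L}"
  proof clarify
    fix n
    obtain z where z: "z \<in> E" "f (2 * n + 1) = \<rho> z" using f(2) by blast
    have "f (2 * n + 1) \<noteq> f (2 * k)" for k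
    proof
      assume "f (2 * n + 1) = f (2 * k)"
      then have "2 * n + 1 = 2 * k" using inj by (simp add: inj_eq)
      then show False by presburger
    qed
    then have "f (2 * n + 1) \<notin> S" by (auto simp: S_def)
    then show "f (2 * n + 1) \<in> \<rho> ` {z \<in> topspace Z. sc_embed Z z \<in> K - L}"
      using L(2)[of z] z by (auto simp: E_def)
  qed
  moreover have "infinite (range (\<lambda>n. f (2 * n + 1)))"
    by (intro range_inj_infinite injI) (simp add: inj_eq[OF inj])
  ultimately have "infinite (\<rho> ` {z \<in> topspace Z. sc_embed Z z \<in> K - L})" by (meson finite_subset)
  then have "(K - L) \<inter> topspace (sc_remainder Z) \<noteq> {}"
    using clopen_meets_remainder_iff[OF clopenin_Diff[OF K(1) L(1)]] by blast
  then have "u \<notin> L" using only by blast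
  then show False using \<open>u \<in> L\<close> by blast
qed

end


section \<open>Ordinals as topological spaces\<close>

lemma Well_order_least:
  assumes "Well_order r" "A \<subseteq> Field r" "A \<noteq> {}"
  shows "\<exists>m\<in>A. \<forall>a\<in>A. (m, a) \<in> r"
proof -
  have "wo_rel r" using assms(1) by (simp add: wo_rel_def)
  then show ?thesis using wo_rel.minim_in[of r A] wo_rel.minim_least[of r A] assms(2,3) by blast
qed

lemma Well_order_facts:
  assumes "Well_order r"
  shows Well_order_refl: "x \<in> Field r \<Longrightarrow> (x, x) \<in> r"
    and Well_order_trans: "(x, y) \<in> r \<Longrightarrow> (y, z) \<in> r \<Longrightarrow> (x, z) \<in> r"
    and Well_order_antisym: "(x, y) \<in> r \<Longrightarrow> (y, x) \<in> r \<Longrightarrow> x = y"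
    and Well_order_total: "x \<in> Field r \<Longrightarrow> y \<in> Field r \<Longrightarrow> (x, y) \<in> r \<or> (y, x) \<in> r"
proof -
  have "refl_on (Field r) r" "trans r" "antisym r" "total_on (Field r) r"
    using assms by (auto simp: order_on_defs)
  then show "x \<in> Field r \<Longrightarrow> (x, x) \<in> r" "(x, y) \<in> r \<Longrightarrow> (y, z) \<in> r \<Longrightarrow> (x, z) \<in> r"
    "(x, y) \<in> r \<Longrightarrow> (y, x) \<in> r \<Longrightarrow> x = y" "x \<in> Field r \<Longrightarrow> y \<in> Field r \<Longrightarrow> (x, y) \<in> r \<or> (y, x) \<in> r"
    by (auto dest: refl_onD transD antisymD simp: total_on_def) (metis refl_onD)
qed

lemma under_subset_Field: "under r x \<subseteq> Field r"
  by (auto simp: under_def Field_def)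

lemma topspace_ord_topology: "topspace (ord_topology r) = Field r"
  by (auto simp: ord_topology_def underS_def aboveS_def Field_def)

lemma openin_underS: "x \<in> Field r \<Longrightarrow> openin (ord_topology r) (underS r x)"
  unfolding ord_topology_def by (rule topology_generated_by_Basis) auto

lemma openin_aboveS: "x \<in> Field r \<Longrightarrow> openin (ord_topology r) (aboveS r x)"
  unfolding ord_topology_def by (rule topology_generated_by_Basis) auto

lemma under_compl:
  assumes "Well_order r" "x \<in> Field r"
  shows "Field r - under r x = aboveS r x"
  using Well_order_total[OF assms(1) _ assms(2)] Well_order_antisym[OF assms(1)] Well_order_refl[OF assms]
  by (auto simp: under_def aboveS_def Field_def)

text \<open>
  Closed initial segments are open because they are open initial segments up to the successor, if there
  is one. They are the clopen sets on which everything below is built.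
\<close>

lemma clopenin_under:
  assumes r: "Well_order r" and x: "x \<in> Field r"
  shows "clopenin (ord_topology r) (under r x)"
proof -
  have "openin (ord_topology r) (under r x)"
  proof (cases "aboveS r x = {}")
    case True
    then have "under r x = topspace (ord_topology r)"
      using under_compl[OF r x] under_subset_Field[of r x] by (auto simp: topspace_ord_topology)
    then show ?thesis by simp
  next
    case False
    have "aboveS r x \<subseteq> Field r" by (auto simp: aboveS_def Field_def)
    then obtain m where m: "m \<in> aboveS r x" "\<forall>a\<in>aboveS r x. (m, a) \<in> r" "m \<in> Field r"
      using Well_order_least[OF r _ False] by blast
    have "under r x = underS r m"
    proof (intro equalityI subsetI)
      fix y assume y: "y \<in> under r x"
      then have "y \<notin> aboveS r x" using under_compl[OF r x] by blast
      then show "y \<in> underS r m"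
        using m(1) y Well_order_trans[OF r, of y x m] by (auto simp: under_def aboveS_def underS_def)
    next
      fix y assume y: "y \<in> underS r m"
      then have "y \<in> Field r" by (auto simp: underS_def Field_def)
      moreover have "y \<notin> aboveS r x"
        using m(2) y Well_order_antisym[OF r] by (auto simp: underS_def)
      ultimately show "y \<in> under r x" using under_compl[OF r x] by blast
    qed
    then show ?thesis using openin_underS[OF m(3)] by simp
  qed
  moreover have "topspace (ord_topology r) - under r x = aboveS r x"
    using under_compl[OF r x] by (simp add: topspace_ord_topology)
  ultimately show ?thesis
    using openin_aboveS[OF x] under_subset_Field[of r x]
    by (simp add: clopenin_def closedin_def topspace_ord_topology)
qed

text \<open>
  As \<open>under r x\<close> is open, the left half-open intervals \<open>(a, x]\<close> form a neighbourhood basis at \<open>x\<close>,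
  together with \<open>under r x\<close> itself in case \<open>x\<close> is the least element.
\<close>

lemma left_neighbourhood:
  assumes r: "Well_order r" and U: "openin (ord_topology r) U" "x \<in> U"
  shows "under r x \<subseteq> U \<or> (\<exists>a\<in>underS r x. under r x - under r a \<subseteq> U)"
proof -
  have mono: "under r a \<subseteq> under r b" if "(a, b) \<in> r" for a b
    using that Well_order_trans[OF r] by (auto simp: under_def)
  have "generate_topology_on (insert (Field r) (underS r ` Field r \<union> aboveS r ` Field r)) U"
    using U(1) unfolding ord_topology_def by (rule openin_topology_generated_by)
  then show ?thesis using U(2)
  proof induction
    case Empty
    then show ?case by simp
  next
    case (Int A B)
    have AF: "underS r x \<subseteq> Field r" by (auto simp: underS_def Field_def)
    from Int consider "under r x \<subseteq> A" "under r x \<subseteq> B"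
      | a where "a \<in> underS r x" "under r x - under r a \<subseteq> A" "under r x \<subseteq> B"
      | b where "b \<in> underS r x" "under r x - under r b \<subseteq> B" "under r x \<subseteq> A"
      | a b where "a \<in> underS r x" "under r x - under r a \<subseteq> A" "b \<in> underS r x" "under r x - under r b \<subseteq> B"
      by blast
    then show ?case
    proof cases
      case 4
      then have "(a, b) \<in> r \<or> (b, a) \<in> r" using Well_order_total[OF r] AF by blast
      then have "under r b \<union> under r a \<subseteq> under r b \<or> under r b \<union> under r a \<subseteq> under r a"
        using mono by blast
      then show ?thesis using 4 by blast
    qed blast+
  next
    case (UN K)
    then show ?case by blast
  next
    case (Basis S)
    then consider "S = Field r" | a where "a \<in> Field r" "S = underS r a" | a where "a \<in> Field r" "S = aboveS r a"
      by blast
    then show ?case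
    proof cases
      case 1
      then show ?thesis using under_subset_Field[of r x] by simp
    next
      case 2
      then have x: "x \<noteq> a" "(x, a) \<in> r" using Basis.prems by (auto simp: underS_def)
      have "under r x \<subseteq> S"
      proof
        fix y assume "y \<in> under r x"
        then have y: "(y, x) \<in> r" by (simp add: under_def)
        have "y \<noteq> a" using y x Well_order_antisym[OF r] by metis
        then show "y \<in> S" using Well_order_trans[OF r y x(2)] 2(2) by (simp add: underS_def)
      qed
      then show ?thesis by blast
    next
      case 3
      then have "a \<in> underS r x" using Basis.prems by (auto simp: aboveS_def underS_def)
      moreover have "under r x - under r a \<subseteq> S"
        using under_compl[OF r 3(1)] under_subset_Field[of r x] 3(2) by blast
      ultimately show ?thesis by blast
    qed
  qed
qed

text \<open>
  By transfinite induction: a set of the cover that contains \<open>x\<close> contains all of \<open>under r x\<close>, or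
  it contains \<open>(a, x]\<close> for some \<open>a < x\<close> and the rest \<open>under r a\<close> is covered by finitely many sets.
\<close>

lemma compactin_under:
  assumes r: "Well_order r"
  shows "compactin (ord_topology r) (under r x)"
proof -
  have wo: "wo_rel r" using r by (simp add: wo_rel_def)
  have "\<exists>\<F>. finite \<F> \<and> \<F> \<subseteq> \<U> \<and> under r x \<subseteq> \<Union>\<F>"
    if \<U>: "\<And>U. U \<in> \<U> \<Longrightarrow> openin (ord_topology r) U" and "under r x \<subseteq> \<Union>\<U>" for \<U>
    using that(2)
  proof (induction x rule: wo_rel.well_order_induct[OF wo])
    case (1 x)
    show ?case
    proof (cases "x \<in> Field r")
      case False
      then have "under r x = {}" by (auto simp: under_def Field_def)
      then show ?thesis by (intro exI[of _ "{}"]) auto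
    next
      case True
      then have "x \<in> under r x" using Well_order_refl[OF r] by (simp add: under_def)
      then obtain U where U: "U \<in> \<U>" "x \<in> U" using 1(2) by blast
      from left_neighbourhood[OF r \<U>[OF U(1)] U(2)] show ?thesis
      proof
        assume "under r x \<subseteq> U"
        then show ?thesis using U by (intro exI[of _ "{U}"]) auto
      next
        assume "\<exists>a\<in>underS r x. under r x - under r a \<subseteq> U"
        then obtain a where a: "a \<noteq> x" "(a, x) \<in> r" "under r x - under r a \<subseteq> U"
          by (auto simp: underS_def)
        have "under r a \<subseteq> under r x" using a(2) Well_order_trans[OF r] by (auto simp: under_def)
        then obtain \<F> where "finite \<F>" "\<F> \<subseteq> \<U>" "under r a \<subseteq> \<Union>\<F>" using 1 a by (metis order_trans)
        then show ?thesis using a(3) U(1) by (intro exI[of _ "insert U \<F>"]) auto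
      qed
    qed
  qed
  then show ?thesis
    using under_subset_Field[of r x] unfolding compactin_def topspace_ord_topology by blast
qed

lemma totally_separated_ord_topology:
  assumes r: "Well_order r"
  shows "totally_separated_space (ord_topology r)"
  unfolding totally_separated_space_def topspace_ord_topology
proof (intro ballI impI)
  fix x y assume x: "x \<in> Field r" and y: "y \<in> Field r" and "x \<noteq> y"
  show "\<exists>K. clopenin (ord_topology r) K \<and> x \<in> K \<and> y \<notin> K"
  proof (cases "(x, y) \<in> r")
    case True
    then have "y \<notin> under r x" using \<open>x \<noteq> y\<close> Well_order_antisym[OF r] by (auto simp: under_def)
    moreover have "x \<in> under r x" using Well_order_refl[OF r x] by (simp add: under_def)
    ultimately show ?thesis using clopenin_under[OF r x] by blast
  next
    case False
    then have "x \<in> Field r - under r y" using x by (simp add: under_def)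
    moreover have "y \<notin> Field r - under r y" using Well_order_refl[OF r y] by (simp add: under_def)
    moreover have "clopenin (ord_topology r) (Field r - under r y)"
      using clopenin_compl[OF clopenin_under[OF r y]] by (simp add: topspace_ord_topology)
    ultimately show ?thesis by blast
  qed
qed

text \<open>
  The least element \<open>m\<close> of an open set \<open>U\<close> is isolated, since \<open>U \<inter> under r m = {m}\<close>.
\<close>

lemma isolated_points_ord_topology_dense:
  assumes r: "Well_order r"
  shows "ord_topology r closure_of isolated_points (ord_topology r) = topspace (ord_topology r)"
proof -
  have "\<exists>m. m \<in> isolated_points (ord_topology r) \<and> m \<in> U"
    if U: "openin (ord_topology r) U" "x \<in> U" for x U
  proof -
    have UF: "U \<subseteq> Field r" using openin_subset[OF U(1)] by (simp add: topspace_ord_topology)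
    then obtain m where m: "m \<in> U" "\<forall>a\<in>U. (m, a) \<in> r"
      using Well_order_least[OF r UF] U(2) by blast
    then have "U \<inter> under r m = {m}"
      using UF Well_order_refl[OF r] Well_order_antisym[OF r] by (auto simp: under_def)
    moreover have "openin (ord_topology r) (U \<inter> under r m)"
      using clopenin_under[OF r, of m] U m UF by (auto simp: clopenin_def)
    ultimately show ?thesis
      using m UF by (auto simp: isolated_points_def topspace_ord_topology)
  qed
  then show ?thesis
    by (auto simp: in_closure_of closure_of_subset_topspace set_eq_iff)
qed

lemma ord_Suc_simps [simp]:
  "(Some x, Some y) \<in> ord_Suc r \<longleftrightarrow> (x, y) \<in> r" "(Some x, None) \<in> ord_Suc r \<longleftrightarrow> x \<in> Field r"
  "(None, Some y) \<notin> ord_Suc r" "(None, None) \<in> ord_Suc r"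
  by (auto simp: ord_Suc_def)

lemma Field_ord_Suc:
  assumes "Well_order r"
  shows "Field (ord_Suc r) = insert None (Some ` Field r)"
  using Well_order_refl[OF assms] by (auto simp: ord_Suc_def Field_def image_def)

lemma Well_order_ord_Suc:
  assumes r: "Well_order r"
  shows "Well_order (ord_Suc r)"
proof -
  note F = Field_ord_Suc[OF r]
  have "refl_on (Field (ord_Suc r)) (ord_Suc r)"
    unfolding F using Well_order_refl[OF r] by (auto simp: refl_on_def ord_Suc_def)
  moreover have "trans (ord_Suc r)"
  proof (rule transI)
    fix x y z assume "(x, y) \<in> ord_Suc r" "(y, z) \<in> ord_Suc r"
    then show "(x, z) \<in> ord_Suc r"
      by (cases x; cases y; cases z) (auto dest: FieldI1 Well_order_trans[OF r])
  qed
  moreover have "antisym (ord_Suc r)"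
  proof (rule antisymI)
    fix x y assume "(x, y) \<in> ord_Suc r" "(y, x) \<in> ord_Suc r"
    then show "x = y" by (cases x; cases y) (auto dest: Well_order_antisym[OF r])
  qed
  moreover have "total_on (Field (ord_Suc r)) (ord_Suc r)"
    unfolding F using Well_order_total[OF r] by (auto simp: total_on_def)
  moreover have "ord_Suc r \<subseteq> Field (ord_Suc r) \<times> Field (ord_Suc r)"
    by (auto intro: FieldI1 FieldI2)
  moreover have "wf (ord_Suc r - Id)"
  proof (rule wfI_min)
    fix x and Q :: "'a option set"
    assume x: "x \<in> Q"
    show "\<exists>z\<in>Q. \<forall>y. (y, z) \<in> ord_Suc r - Id \<longrightarrow> y \<notin> Q"
    proof (cases "\<exists>a\<in>Field r. Some a \<in> Q")
      case True
      then obtain m where m: "m \<in> Field r" "Some m \<in> Q" "\<And>a. a \<in> Field r \<Longrightarrow> Some a \<in> Q \<Longrightarrow> (m, a) \<in> r"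
        using Well_order_least[OF r, of "{a \<in> Field r. Some a \<in> Q}"] by blast
      have "y \<notin> Q" if "(y, Some m) \<in> ord_Suc r - Id" for y
      proof
        assume "y \<in> Q"
        from that obtain b where b: "y = Some b" "(b, m) \<in> r" "b \<noteq> m" by (auto simp: ord_Suc_def)
        then have "b \<in> Field r" by (auto simp: Field_def)
        then show False using m(3)[of b] b \<open>y \<in> Q\<close> Well_order_antisym[OF r] by blast
      qed
      then show ?thesis using m(2) by blast
    next
      case False
      then have "\<forall>y. (y, x) \<in> ord_Suc r - Id \<longrightarrow> y \<notin> Q" by (auto simp: ord_Suc_def Field_def)
      then show ?thesis using x by blast
    qed
  qed
  ultimately show ?thesis by (simp add: order_on_defs)
qed

lemma compact_ord_Suc:
  assumes r: "Well_order r"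
  shows "compact_space (ord_topology (ord_Suc r))"
proof -
  have "under (ord_Suc r) None = topspace (ord_topology (ord_Suc r))"
    unfolding topspace_ord_topology Field_ord_Suc[OF r] by (auto simp: under_def ord_Suc_def)
  then show ?thesis
    using compactin_under[OF Well_order_ord_Suc[OF r], of None] by (simp add: compact_space_def)
qed

text \<open>
  Along an enumeration \<open>e\<close> of the ordinal, send \<open>x\<close> to the first index \<open>n\<close> with \<open>x \<le> e n\<close>. The
  sublevel sets are finite unions of closed initial segments, hence clopen, compact and, the ordinal being
  a limit, not everything.
\<close>

lemma countable_limit_ordinal_exhausted:
  assumes lim: "limit_ordinal r" and cnt: "countable (Field r)"
  shows "\<exists>\<rho>. exhausted_space (ord_topology r) \<rho>"
proof -
  have r: "Well_order r" and ne: "Field r \<noteq> {}"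
    and up: "\<And>x. x \<in> Field r \<Longrightarrow> \<exists>y\<in>Field r. (x, y) \<in> r \<and> x \<noteq> y"
    using lim by (auto simp: limit_ordinal_def)
  define e where "e = from_nat_into (Field r)"
  have e: "range e = Field r" unfolding e_def by (rule range_from_nat_into[OF ne cnt])
  define \<rho> where "\<rho> x = (LEAST n. (x, e n) \<in> r)" for x
  have ex: "\<exists>n. (x, e n) \<in> r" if "x \<in> Field r" for x
    using Well_order_refl[OF r that] that e by (metis imageE)
  have le: "{z \<in> Field r. \<rho> z \<le> m} = (\<Union>n\<le>m. under r (e n))" for m
  proof (intro equalityI subsetI)
    fix z assume "z \<in> {z \<in> Field r. \<rho> z \<le> m}"
    then show "z \<in> (\<Union>n\<le>m. under r (e n))"
      using LeastI_ex[OF ex, of z] by (auto simp: \<rho>_def under_def)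
  next
    fix z assume "z \<in> (\<Union>n\<le>m. under r (e n))"
    then obtain n where "n \<le> m" "(z, e n) \<in> r" by (auto simp: under_def)
    then show "z \<in> {z \<in> Field r. \<rho> z \<le> m}"
      using Least_le[of "\<lambda>n. (z, e n) \<in> r" n] by (auto simp: \<rho>_def Field_def)
  qed
  have cl: "clopenin (ord_topology r) {z \<in> Field r. \<rho> z \<le> m}" for m
  proof -
    have "clopenin (ord_topology r) (under r (e n))" for n
      using clopenin_under[OF r] e by blast
    then have "openin (ord_topology r) (\<Union>n\<le>m. under r (e n))" "closedin (ord_topology r) (\<Union>n\<le>m. under r (e n))"
      by (auto simp: clopenin_def intro!: closedin_Union)
    then show ?thesis unfolding le by (simp add: clopenin_def)
  qed
  have "locally_constant (ord_topology r) \<rho>"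
    unfolding locally_constant_def topspace_ord_topology
  proof
    fix m
    show "openin (ord_topology r) {z \<in> Field r. \<rho> z = m}"
    proof (cases m)
      case 0
      then have "{z \<in> Field r. \<rho> z = m} = {z \<in> Field r. \<rho> z \<le> 0}" by auto
      then show ?thesis using cl[of 0] by (simp add: clopenin_def)
    next
      case (Suc n)
      then have "{z \<in> Field r. \<rho> z = m} = {z \<in> Field r. \<rho> z \<le> Suc n} - {z \<in> Field r. \<rho> z \<le> n}" by auto
      then show ?thesis using clopenin_Diff[OF cl[of "Suc n"] cl[of n]] by (simp add: clopenin_def)
    qed
  qed
  moreover have "compactin (ord_topology r) {z \<in> Field r. \<rho> z \<le> m}" for m
    unfolding le by (rule compactin_Union) (auto simp: compactin_under[OF r])
  moreover have "infinite (\<rho> ` Field r)"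
  proof
    assume "finite (\<rho> ` Field r)"
    then obtain m where m: "\<And>z. z \<in> Field r \<Longrightarrow> \<rho> z \<le> m"
      by (metis finite_nat_set_iff_bounded_le image_eqI)
    have top: "\<exists>b\<in>Field r. (\<Union>n\<le>k. under r (e n)) \<subseteq> under r b" for k
    proof (induction k)
      case 0
      then show ?case using e by auto
    next
      case (Suc k)
      then obtain b where b: "b \<in> Field r" "(\<Union>n\<le>k. under r (e n)) \<subseteq> under r b" by blast
      have "e (Suc k) \<in> Field r" using e by blast
      then have "(b, e (Suc k)) \<in> r \<or> (e (Suc k), b) \<in> r" using Well_order_total[OF r b(1)] by blast
      then have "under r b \<union> under r (e (Suc k)) \<subseteq> under r b \<or>
          under r b \<union> under r (e (Suc k)) \<subseteq> under r (e (Suc k))"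
        using Well_order_trans[OF r] by (auto simp: under_def)
      moreover have "(\<Union>n\<le>Suc k. under r (e n)) = under r (e (Suc k)) \<union> (\<Union>n\<le>k. under r (e n))"
        by (simp add: atMost_Suc)
      ultimately have "(\<Union>n\<le>Suc k. under r (e n)) \<subseteq> under r b \<or>
          (\<Union>n\<le>Suc k. under r (e n)) \<subseteq> under r (e (Suc k))"
        using b(2) by (elim disjE) auto
      then show ?case using b(1) \<open>e (Suc k) \<in> Field r\<close> by blast
    qed
    have "Field r \<subseteq> {z \<in> Field r. \<rho> z \<le> m}" using m by auto
    then obtain b where b: "b \<in> Field r" "Field r \<subseteq> under r b"
      using top[of m] unfolding le by (meson order_trans)
    then obtain y where "y \<in> Field r" "(b, y) \<in> r" "b \<noteq> y" using up by blast
    then show False using b Well_order_antisym[OF r] by (auto simp: under_def)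
  qed
  ultimately have "exhausted_space (ord_topology r) \<rho>"
    using cnt by unfold_locales (simp_all add: topspace_ord_topology)
  then show ?thesis by blast
qed

lemma limit_ordinal_natLeq: "limit_ordinal natLeq"
  unfolding limit_ordinal_def
proof (intro conjI ballI)
  show "\<exists>y\<in>Field natLeq. (x, y) \<in> natLeq \<and> x \<noteq> y" for x
    by (rule bexI[of _ "Suc x"]) (simp_all only: Field_natLeq, simp_all add: natLeq_def)
qed (rule natLeq_Well_order, simp add: Field_natLeq)

lemma clopenin_omega_singleton: "clopenin omega_space {n}"
proof -
  have "clopenin omega_space (under natLeq n)" for n
    by (rule clopenin_under[OF natLeq_Well_order]) (simp add: Field_natLeq)
  then have u: "clopenin omega_space {..n}" for n
    by (simp add: under_def natLeq_def atMost_def)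
  show ?thesis
  proof (cases n)
    case 0
    then have "{n} = {..0}" by auto
    then show ?thesis using u[of 0] by simp
  next
    case (Suc k)
    then have "{n} = {..Suc k} - {..k}" by auto
    then show ?thesis using clopenin_Diff[OF u u] by simp
  qed
qed


section \<open>Elementary equivalence from counting isolated points\<close>

lemma zero_dimensional_Hausdorff_imp_totally_separated:
  assumes "zero_dimensional_space X" "Hausdorff_space X"
  shows "totally_separated_space X"
  unfolding totally_separated_space_def
proof (intro ballI impI)
  fix x y assume "x \<in> topspace X" "y \<in> topspace X" "x \<noteq> y"
  then obtain U V where U: "openin X U" "x \<in> U" and V: "y \<in> V" "disjnt U V"
    using assms(2) unfolding Hausdorff_space_def by meson
  obtain \<B> where \<B>: "\<forall>B\<in>\<B>. openin X B \<and> closedin X B" "openin X = arbitrary union_of (\<lambda>B. B \<in> \<B>)"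
    using assms(1) unfolding zero_dimensional_space_def by blast
  have "(arbitrary union_of (\<lambda>B. B \<in> \<B>)) U" using U(1) \<B>(2) by simp
  then obtain B where "B \<in> \<B>" "x \<in> B" "B \<subseteq> U"
    using U(2) unfolding arbitrary_union_of_alt by blast
  then show "\<exists>K. clopenin X K \<and> x \<in> K \<and> y \<notin> K"
    using \<B>(1) V by (auto simp: clopenin_def disjnt_iff)
qed

lemma isolated_points_subset: "isolated_points X \<subseteq> topspace X"
  by (auto simp: isolated_points_def)

lemma finite_isolated_points_closed:
  assumes "totally_separated_space X" "finite (isolated_points X)"
  shows "clopenin X (isolated_points X)" "X closure_of isolated_points X = isolated_points X"
proof -
  show *: "clopenin X (isolated_points X)" by (rule clopenin_finite_isolated[OF assms order_refl])
  then show "X closure_of isolated_points X = isolated_points X"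
    by (simp add: clopenin_def closure_of_closedin)
qed

lemma finite_isolated_points_elem_equiv:
  assumes X: "compact_space X" "totally_separated_space X" "finite (isolated_points X)" "topspace X \<noteq> isolated_points X"
    and Y: "compact_space Y" "totally_separated_space Y" "finite (isolated_points Y)" "topspace Y \<noteq> isolated_points Y"
    and card: "card (isolated_points X) = card (isolated_points Y)"
  shows "C_alg X \<equiv>\<^sub>e C_alg Y"
proof (rule tame_spaces_elem_equiv)
  note cX = finite_isolated_points_closed[OF X(2,3)] and cY = finite_isolated_points_closed[OF Y(2,3)]
  show "tame_space X" using X cX by (simp add: tame_space_def clopenin_def)
  show "tame_space Y" using Y cY by (simp add: tame_space_def clopenin_def)
  show "similar X Y T (topspace X) (topspace Y)" for T
    using X(3,4) Y(3,4) card isolated_points_subset[of X] isolated_points_subset[of Y]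
    by (auto simp: similar_def cX cY trunc_card_def inf.absorb2)
qed

lemma perfect_elem_equiv:
  assumes "compact_space X" "totally_separated_space X" "isolated_points X = {}" "topspace X \<noteq> {}"
    and "compact_space Y" "totally_separated_space Y" "isolated_points Y = {}" "topspace Y \<noteq> {}"
  shows "C_alg X \<equiv>\<^sub>e C_alg Y"
  by (rule finite_isolated_points_elem_equiv) (use assms in auto)

lemma dense_isolated_points_infinite:
  assumes "totally_separated_space X" "infinite (topspace X)" "X closure_of isolated_points X = topspace X"
  shows "infinite (isolated_points X)"
  using finite_isolated_points_closed(2)[OF assms(1)] assms(2,3) by auto

lemma dense_isolated_points_elem_equiv:
  assumes X: "compact_space X" "totally_separated_space X" "infinite (topspace X)"
      "X closure_of isolated_points X = topspace X"
    and Y: "compact_space Y" "totally_separated_space Y" "infinite (topspace Y)"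
      "Y closure_of isolated_points Y = topspace Y"
  shows "C_alg X \<equiv>\<^sub>e C_alg Y"
proof (rule tame_spaces_elem_equiv)
  show "tame_space X" using X by (simp add: tame_space_def)
  show "tame_space Y" using Y by (simp add: tame_space_def)
  show "similar X Y T (topspace X) (topspace Y)" for T
    using dense_isolated_points_infinite[OF X(2-4)] dense_isolated_points_infinite[OF Y(2-4)]
      isolated_points_subset[of X] isolated_points_subset[of Y] X(4) Y(4)
    by (simp add: similar_def trunc_card_def inf.absorb2)
qed

section \<open>The Cantor space and \<open>\<beta>\<omega>\<close>\<close>

lemma topspace_cantor_space: "topspace cantor_space = UNIV"
  by (simp add: cantor_space_def)

lemma compact_cantor_space: "compact_space cantor_space"
  unfolding cantor_space_def by (simp add: compact_space_product_topology compact_space_discrete_topology)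

lemma totally_separated_cantor_space: "totally_separated_space cantor_space"
  unfolding totally_separated_space_def
proof (intro ballI impI)
  fix x y :: "nat \<Rightarrow> bool" assume "x \<noteq> y"
  then obtain i where i: "x i \<noteq> y i" by auto
  have "continuous_map cantor_space (discrete_topology UNIV) (\<lambda>w. w i)"
    unfolding cantor_space_def by (rule continuous_map_product_projection) simp
  from clopenin_preimage[OF this, of "{x i}"]
  have "clopenin cantor_space {w \<in> topspace cantor_space. w i \<in> {x i}}" by (simp add: clopenin_def)
  then show "\<exists>K. clopenin cantor_space K \<and> x \<in> K \<and> y \<notin> K"
    using i by (intro exI[of _ "{w \<in> topspace cantor_space. w i \<in> {x i}}"]) (auto simp: topspace_cantor_space)
qed

lemma isolated_points_cantor_space: "isolated_points cantor_space = {}"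
proof (rule ccontr)
  assume "isolated_points cantor_space \<noteq> {}"
  then obtain x where "openin cantor_space {x}" by (auto simp: isolated_points_def)
  from product_topology_open_contains_basis[OF this[unfolded cantor_space_def], of x]
  obtain V where V: "x \<in> PiE UNIV V" "finite {i. V i \<noteq> (UNIV :: bool set)}" "PiE UNIV V \<subseteq> {x}" by auto
  obtain i where "i \<notin> {i. V i \<noteq> UNIV}" using ex_new_if_finite[OF infinite_UNIV_nat V(2)] by blast
  then have "x(i := \<not> x i) \<in> PiE UNIV V" using V(1) by (auto simp: PiE_UNIV_domain Pi_iff)
  then have "x(i := \<not> x i) = x" using V(3) by blast
  then have "(x(i := \<not> x i)) i = x i" by (rule arg_cong)
  then show False by simp
qed

lemma topspace_omega_space: "topspace omega_space = UNIV"
  by (simp add: topspace_ord_topology Field_natLeq)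

lemma countable_omega_space: "countable (topspace omega_space)"
  by simp

lemma sc_embed_isolated: "sc_embed omega_space n \<in> isolated_points (stone_cech omega_space)"
  using sc_singleton_clopen(1)[OF clopenin_omega_singleton countable_omega_space, of n]
    sc_embed_in_stone_cech[of n omega_space]
  by (simp add: isolated_points_def clopenin_def topspace_omega_space)

lemma infinite_stone_cech_omega: "infinite (topspace (stone_cech omega_space))"
proof -
  have "inj (sc_embed omega_space)"
    using sc_singleton_clopen(2)[OF clopenin_omega_singleton countable_omega_space]
    by (intro injI) (simp add: topspace_omega_space)
  then have "infinite (range (sc_embed omega_space))" by (rule range_inj_infinite)
  moreover have "range (sc_embed omega_space) \<subseteq> topspace (stone_cech omega_space)"
    using subsetD[OF isolated_points_subset sc_embed_isolated] by (simp add: image_subset_iff)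
  ultimately show ?thesis by (meson finite_subset)
qed

lemma isolated_points_stone_cech_omega_dense:
  "stone_cech omega_space closure_of isolated_points (stone_cech omega_space) = topspace (stone_cech omega_space)"
proof (rule equalityI[OF closure_of_subset_topspace sc_dense])
  show "sc_embed omega_space n \<in> stone_cech omega_space closure_of isolated_points (stone_cech omega_space)" for n
    by (rule subsetD[OF closure_of_subset[OF isolated_points_subset] sc_embed_isolated])
qed simp

theorem corollary5p10:
  shows
    "(\<forall>(X :: 'a topology) (Y :: 'b topology).
        infinite (topspace X) \<and> compact_space X \<and> Hausdorff_space X \<and> zero_dimensional_space X \<and>
        infinite (topspace Y) \<and> compact_space Y \<and> Hausdorff_space Y \<and> zero_dimensional_space Y \<and>
        (finite (isolated_points X) \<and> finite (isolated_points Y) \<and>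
           card (isolated_points X) = card (isolated_points Y)
         \<or> X closure_of isolated_points X = topspace X \<and>
           Y closure_of isolated_points Y = topspace Y)
        \<longrightarrow> C_alg X \<equiv>\<^sub>e C_alg Y)
     \<and> (\<forall>\<alpha> :: 'c rel. Well_order \<alpha> \<and> infinite (Field \<alpha>)
        \<longrightarrow> C_alg (ord_topology (ord_Suc \<alpha>)) \<equiv>\<^sub>e C_alg (stone_cech omega_space))
     \<and> (\<forall>\<alpha> :: 'd rel. limit_ordinal \<alpha> \<and> countable (Field \<alpha>)
        \<longrightarrow> C_alg cantor_space \<equiv>\<^sub>e C_alg (sc_remainder omega_space)
          \<and> C_alg (sc_remainder omega_space) \<equiv>\<^sub>e C_alg (sc_remainder (ord_topology \<alpha>)))"
proof (intro conjI allI impI; (elim conjE)?)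
  fix X :: "'a topology" and Y :: "'b topology"
  assume X: "infinite (topspace X)" "compact_space X" "Hausdorff_space X" "zero_dimensional_space X"
    and Y: "infinite (topspace Y)" "compact_space Y" "Hausdorff_space Y" "zero_dimensional_space Y"
    and iso: "finite (isolated_points X) \<and> finite (isolated_points Y) \<and>
           card (isolated_points X) = card (isolated_points Y)
         \<or> X closure_of isolated_points X = topspace X \<and>
           Y closure_of isolated_points Y = topspace Y"
  note tX = zero_dimensional_Hausdorff_imp_totally_separated[OF X(4,3)]
    and tY = zero_dimensional_Hausdorff_imp_totally_separated[OF Y(4,3)]
  from iso show "C_alg X \<equiv>\<^sub>e C_alg Y"
  proof (elim disjE conjE)
    assume "finite (isolated_points X)" "finite (isolated_points Y)"
      "card (isolated_points X) = card (isolated_points Y)"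
    then show ?thesis
      by (intro finite_isolated_points_elem_equiv X(2) Y(2) tX tY) (use X(1) Y(1) in auto)
  next
    assume "X closure_of isolated_points X = topspace X" "Y closure_of isolated_points Y = topspace Y"
    then show ?thesis
      by (intro dense_isolated_points_elem_equiv X(1,2) Y(1,2) tX tY)
  qed
next
  fix \<alpha> :: "'c rel" assume "Well_order \<alpha>" "infinite (Field \<alpha>)"
  note r = Well_order_ord_Suc[OF \<open>Well_order \<alpha>\<close>]
  have "infinite (topspace (ord_topology (ord_Suc \<alpha>)))"
    using \<open>infinite (Field \<alpha>)\<close>
    by (simp add: topspace_ord_topology Field_ord_Suc[OF \<open>Well_order \<alpha>\<close>] finite_image_iff)
  then show "C_alg (ord_topology (ord_Suc \<alpha>)) \<equiv>\<^sub>e C_alg (stone_cech omega_space)"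
    by (intro dense_isolated_points_elem_equiv compact_ord_Suc[OF \<open>Well_order \<alpha>\<close>] totally_separated_ord_topology[OF r]
        isolated_points_ord_topology_dense[OF r] compact_stone_cech totally_separated_stone_cech[OF countable_omega_space]
        infinite_stone_cech_omega isolated_points_stone_cech_omega_dense)
next
  obtain \<rho> :: "nat \<Rightarrow> nat" where "exhausted_space omega_space \<rho>"
    using countable_limit_ordinal_exhausted[OF limit_ordinal_natLeq] by auto
  then interpret \<omega>: exhausted_space omega_space \<rho> .
  show "C_alg cantor_space \<equiv>\<^sub>e C_alg (sc_remainder omega_space)"
    by (intro perfect_elem_equiv compact_cantor_space totally_separated_cantor_space isolated_points_cantor_space
        \<omega>.compact_remainder \<omega>.totally_separated_remainder \<omega>.remainder_no_isolated_points \<omega>.remainder_nonempty)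
      (simp add: topspace_cantor_space)
  fix \<alpha> :: "'d rel" assume "limit_ordinal \<alpha>" "countable (Field \<alpha>)"
  then obtain \<rho>' where "exhausted_space (ord_topology \<alpha>) \<rho>'"
    using countable_limit_ordinal_exhausted by blast
  then interpret \<alpha>: exhausted_space "ord_topology \<alpha>" \<rho>' .
  show "C_alg (sc_remainder omega_space) \<equiv>\<^sub>e C_alg (sc_remainder (ord_topology \<alpha>))"
    by (intro perfect_elem_equiv \<omega>.compact_remainder \<omega>.totally_separated_remainder \<omega>.remainder_no_isolated_points
        \<omega>.remainder_nonempty \<alpha>.compact_remainder \<alpha>.totally_separated_remainder \<alpha>.remainder_no_isolated_points
        \<alpha>.remainder_nonempty)
qed


end
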